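(* Let $d$ and $k$ be integers with $1\le k\le d-1$. There is a constant $C=C(d,k)>0$ depending only on $d$ and $k$ such that the following holds. Let $\Lambda\subseteq\mathbb{R}^d$ be a $d$-dimensional lattice and let $K\subseteq\mathbb{R}^d$ be a $d$-dimensional compact convex body symmetric about the origin, and write $\lambda_i=\lambda_i(\Lambda,K)$ for $i=1,\dots,d$. If $\lambda_d\le 1$, then $\Lambda\cap K$ can be covered by at most $C\,\alpha^{d-k}$ $k$-dimensional linear subspaces of $\mathbb{R}^d$, where \[\alpha = \min_{1\le j\le k}(\lambda_j\cdots\lambda_d)^{-1/(d-j)}.\]
   Context: A $d$-dimensional lattice is the set of all integer linear combinations of $d$ linearly independent vectors of $\mathbb{R}^d$. For a lattice $\Lambda$ and a compact convex body $K$ symmetric about the origin ($K=-K$), the $i$th successive minimum is $\lambda_i(\Lambda,K)=\inf\{\lambda\in\mathbb{R}:\dim(\Lambda\cap(\lambda K))\ge i\}$, where $\dim$ denotes the dimension of the affine hull. A family of sets covers a point set $P$ if every point of $P$ lies in some set of the family. *)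

theory Defs
  imports "HOL-Analysis.Analysis"
begin

text \<open>A full-rank lattice: all integer combinations of DIM('a) linearly independent vectors.\<close>
definition is_lattice :: "'a::euclidean_space set \<Rightarrow> bool" where
  "is_lattice L \<longleftrightarrow> (\<exists>B. independent B \<and> card B = DIM('a) \<and>
      L = {\<Sum>b\<in>B. c b *\<^sub>R b | c. \<forall>b\<in>B. c b \<in> \<int>})"

text \<open>A d-dimensional compact convex body symmetric about the origin.\<close>
definition sym_convex_body :: "'a::euclidean_space set \<Rightarrow> bool" where
  "sym_convex_body K \<longleftrightarrow> compact K \<and> convex K \<and> aff_dim K = int DIM('a) \<and> uminus ` K = K"

text \<open>i-th successive minimum (scaling factors restricted to be positive).\<close>
definition succ_min :: "'a::euclidean_space set \<Rightarrow> 'a set \<Rightarrow> nat \<Rightarrow> real" where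
  "succ_min L K i = Inf {lam. lam > 0 \<and> aff_dim (L \<inter> ((*\<^sub>R) lam ` K)) \<ge> int i}"

end

theory Submission
  imports Defs
begin

text \<open>
Let \<open>b\<close> be a basis of the lattice adapted to the successive minima. Counting lattice points shows
that the \<open>i\<close>-th coordinate of a point of \<open>L \<inter> K\<close> is \<open>O(1/\<lambda>\<^sub>i)\<close>. Choose \<open>j\<close> minimising \<open>\<alpha>\<close>, keep
the \<open>q = d - j + 1\<close> coordinates from \<open>j\<close> on, put \<open>n\<^sub>i = 1/\<lambda>\<^sub>i\<close> and let \<open>V\<close> be the product of the
\<open>n\<^sub>i\<close> kept, so that \<open>V = \<alpha>\<close> to the power \<open>q - 1\<close>.
Every \<open>z\<close> is orthogonal to many integer vectors (pigeonhole on the values of the inner product), hence,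
for \<open>r = d - k\<close>, the first \<open>r\<close> minima \<open>\<mu>\<^sub>1 \<le> \<dots> \<le> \<mu>\<^sub>r\<close> of its orthogonal lattice, measured with weights
\<open>n\<^sub>i\<close>, have product \<open>O(V)\<close> when
the last factor \<open>\<mu>\<^sub>r\<close> is taken \<open>q - r\<close> times. The subspace assigned to
\<open>z\<close> is the orthogonal complement of the first \<open>r\<close> minimal vectors.
The spans with \<open>\<mu>\<^sub>l\<close> in prescribed dyadic ranges are counted by adding one vector at a time modulo the
span of the previous ones; this quotient makes the count decay geometrically away from the case
where all \<open>\<mu>\<^sub>l\<close> are about \<open>\<alpha>\<close>, so summing over the dyadic ranges costs no logarithm. For \<open>j = k\<close> this decay
fails, but there the kept coordinate vectors can be counted directly.
\<close>

section \<open>Minima of discrete subgroups\<close>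

text \<open>Everything rests on counting, without volumes. A group with minima \<mu>_1, ..., \<mu>_i
  has O(\<rho>^i / (\<mu>_1 ... \<mu>_i)) points in a ball of large radius \<rho>, while pigeonhole
  gives at least order \<rho>^(q-1) / V integer vectors orthogonal to z. For large \<rho> the
  comparison shows that the orthogonal lattice has rank at least q - 1; at half of \<mu>_r it bounds
  the product of the minima. The repeated \<mu>_r stands for the later minima, which are at least as
  large. The obstacle is the sum over dyadic ranges. With w_l = log_2(\<mu>_l / \<alpha>) the
  logarithm of a span count is at most r log_2 \<alpha> plus a constant plus a piecewise linear
  function of w, while the product bound is one linear constraint on w. Boundedness of that function
  would still cost powers of log \<alpha>; it has to drop linearly in |w|. The drop comes from q - r
  \<ge> 2, that is j < k. If j = k, the number of coordinate vectors is O(V) = O(\<alpha>^r),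
  already the required order. The hypothesis \<lambda>_d \<le> 1 gives n_i \<ge> 1, so that rounding
  costs only constants.\<close>

lemma seq_independent:
  fixes x :: "nat \<Rightarrow> 'a::euclidean_space"
  assumes "\<And>i. i < m \<Longrightarrow> x i \<notin> span (x ` {..<i})"
  shows "inj_on x {..<m} \<and> independent (x ` {..<m})"
  using assms
proof (induction m)
  case 0
  then show ?case by (simp add: independent_empty)
next
  case (Suc m)
  have IH: "inj_on x {..<m}" "independent (x ` {..<m})" using Suc by auto
  have "x m \<notin> span (x ` {..<m})" using Suc.prems by auto
  then show ?case using IH
    by (auto simp: lessThan_Suc independent_insert span_base)
qed

lemma dual_seq:
  fixes x :: "nat \<Rightarrow> 'a::euclidean_space"
  assumes "\<And>i. i < m \<Longrightarrow> x i \<notin> span (x ` {..<i})"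
  obtains y where "\<And>i j. i < m \<Longrightarrow> j < m \<Longrightarrow> y i \<bullet> x j = (if i = j then 1 else 0)"
proof -
  have inj: "inj_on x {..<m}" and ind: "independent (x ` {..<m})"
    using seq_independent[of m x] assms by auto
  have "\<exists>u. \<forall>j<m. u \<bullet> x j = (if i = j then 1 else 0)" if "i < m" for i
  proof -
    obtain f :: "'a \<Rightarrow> real" where f: "linear f"
      "\<forall>v\<in>x ` {..<m}. f v = (if v = x i then 1 else 0)"
      using linear_independent_extend[OF ind, of "\<lambda>v. if v = x i then 1 else 0"] by auto
    \<comment> \<open>\<open>adjoint f 1\<close> is the vector that represents the functional
      \<open>f\<close>.\<close>
    have "adjoint f 1 \<bullet> x j = (if i = j then 1 else 0)" if "j < m" for j
    proof -
      have "adjoint f 1 \<bullet> x j = f (x j)"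
        using adjoint_works[OF f(1), of "x j" 1] by (simp add: inner_commute)
      also have "\<dots> = (if i = j then 1 else 0)"
        using f(2) inj \<open>i < m\<close> that by (auto simp: inj_on_def)
      finally show ?thesis .
    qed
    then show ?thesis by blast
  qed
  then obtain y where "\<forall>i<m. \<forall>j<m. y i \<bullet> x j = (if i = j then 1 else 0)"
    by metis
  then show thesis using that by blast
qed

lemma inner_comb_dual:
  assumes "finite I" "j \<in> I" "\<And>l. l \<in> I \<Longrightarrow> x l \<bullet> u = (if l = j then 1 else 0)"
  shows "(\<Sum>l\<in>I. c l *\<^sub>R x l) \<bullet> u = c j"
proof -
  have "(\<Sum>l\<in>I. c l *\<^sub>R x l) \<bullet> u = (\<Sum>l\<in>I. c l * (if l = j then 1 else 0))"
    using assms by (auto simp: inner_sum_left intro!: sum.cong)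
  then show ?thesis using assms by (simp add: if_distrib cong: if_cong)
qed

lemma comb_inj:
  fixes x :: "nat \<Rightarrow> 'a::euclidean_space"
  assumes "\<And>i. i < m \<Longrightarrow> x i \<notin> span (x ` {..<i})"
    and "(\<Sum>l<m. c l *\<^sub>R x l) = (\<Sum>l<m. c' l *\<^sub>R x l)" and "j < m"
  shows "c j = c' j"
proof -
  obtain y where y: "\<And>i j. i < m \<Longrightarrow> j < m \<Longrightarrow> y i \<bullet> x j = (if i = j then 1 else 0)"
    using dual_seq[of m x] assms(1) by metis
  have "(\<Sum>l<m. a l *\<^sub>R x l) \<bullet> y j = a j" for a
    using \<open>j < m\<close> y by (intro inner_comb_dual) (auto simp: inner_commute)
  then show ?thesis using assms(2) by metis
qed

lemma comb_inj_on:
  fixes x :: "nat \<Rightarrow> 'a::euclidean_space"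
  assumes "\<And>i. i < m \<Longrightarrow> x i \<notin> span (x ` {..<i})" and "inj (f :: 'b \<Rightarrow> real)"
  shows "inj_on (\<lambda>c. \<Sum>l<m. f (c l) *\<^sub>R x l) (PiE {..<m} A)"
proof (rule inj_onI)
  fix c c' assume c: "c \<in> PiE {..<m} A" "c' \<in> PiE {..<m} A"
    and eq: "(\<Sum>l<m. f (c l) *\<^sub>R x l) = (\<Sum>l<m. f (c' l) *\<^sub>R x l)"
  have "f (c j) = f (c' j)" if "j < m" for j
    using comb_inj[of m x "\<lambda>l. f (c l)" "\<lambda>l. f (c' l)" j] assms(1) eq that by metis
  then have "c j = c' j" if "j < m" for j using that assms(2) by (metis injD)
  then show "c = c'" using c by (intro PiE_ext) auto
qed

text \<open>\<open>p\<close> is only a seminorm on the whole space; finiteness of the balls in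
  \<open>G\<close> supplies discreteness and, through \<open>p_pos\<close>, definiteness on
  \<open>G\<close>. The generality matters for dual boxes, whose weighted norm vanishes on vectors
  orthogonal to all the \<open>w l\<close>.\<close>

locale normed_subgroup =
  fixes G :: "'a::euclidean_space set" and p :: "'a \<Rightarrow> real"
  assumes zero_mem: "0 \<in> G"
    and diff_mem: "\<And>x y. x \<in> G \<Longrightarrow> y \<in> G \<Longrightarrow> x - y \<in> G"
    and p_add: "\<And>x y. p (x + y) \<le> p x + p y"
    and p_scale: "\<And>a x. p (a *\<^sub>R x) = \<bar>a\<bar> * p x"
    and finite_ball: "\<And>\<rho>. finite {x \<in> G. p x \<le> \<rho>}"
begin

lemma minus_mem: "x \<in> G \<Longrightarrow> - x \<in> G"
  using diff_mem[OF zero_mem, of x] by simp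

lemma add_mem: "x \<in> G \<Longrightarrow> y \<in> G \<Longrightarrow> x + y \<in> G"
  using diff_mem[of x "- y"] minus_mem[of y] by simp

lemma nat_scale_mem: "x \<in> G \<Longrightarrow> real n *\<^sub>R x \<in> G"
  by (induction n) (auto simp: zero_mem add_mem scaleR_left_distrib)

lemma int_scale_mem: "x \<in> G \<Longrightarrow> real_of_int n *\<^sub>R x \<in> G"
proof (cases "n \<ge> 0")
  case True
  assume "x \<in> G"
  then show ?thesis using nat_scale_mem[of x "nat n"] True by simp
next
  case False
  assume "x \<in> G"
  then show ?thesis using minus_mem[OF nat_scale_mem[of x "nat (-n)"]] False by simp
qed

lemma sum_mem: "(\<And>i. i \<in> I \<Longrightarrow> f i \<in> G) \<Longrightarrow> (\<Sum>i\<in>I. f i) \<in> G"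
  by (induction I rule: infinite_finite_induct) (auto simp: zero_mem add_mem)

lemma p_zero [simp]: "p 0 = 0"
  using p_scale[of 0 0] by simp

lemma p_minus: "p (- x) = p x"
  using p_scale[of "-1" x] by simp

lemma p_nonneg: "0 \<le> p x"
  using p_add[of x "- x"] by (simp add: p_minus)

lemma p_diff: "p (x - y) \<le> p x + p y"
  using p_add[of x "- y"] by (simp add: p_minus)

lemma p_sum: "p (\<Sum>i\<in>I. f i) \<le> (\<Sum>i\<in>I. p (f i))"
proof (induction I rule: infinite_finite_induct)
  case (insert x F)
  then show ?case using p_add[of "f x" "sum f F"] by simp
qed auto

lemma p_pos:
  assumes "x \<in> G" "x \<noteq> 0"
  shows "0 < p x"
proof (rule ccontr)
  assume "\<not> 0 < p x"
  then have "p x = 0" using p_nonneg[of x] by simp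
  then have "range (\<lambda>n. real n *\<^sub>R x) \<subseteq> {y \<in> G. p y \<le> 0}"
    using assms nat_scale_mem p_scale by auto
  then have "finite (range (\<lambda>n. real n *\<^sub>R x))"
    using finite_ball finite_subset by blast
  moreover have "inj (\<lambda>n. real n *\<^sub>R x)" using assms by (auto simp: inj_on_def)
  ultimately show False using finite_imageD by blast
qed

text \<open>Attained successive minima, numbered from 0. Keeping the vectors and not only their
  sizes fixes a flag of spans, along which bases are chosen and points are counted.\<close>

definition minima :: "nat \<Rightarrow> (nat \<Rightarrow> 'a) \<Rightarrow> bool" where
  "minima m x \<longleftrightarrow> (\<forall>i<m. x i \<in> G \<and> x i \<notin> span (x ` {..<i}) \<and>
     (\<forall>g\<in>G. g \<notin> span (x ` {..<i}) \<longrightarrow> p (x i) \<le> p g))"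

lemma minima_mem: "minima m x \<Longrightarrow> i < m \<Longrightarrow> x i \<in> G"
  and minima_notin: "minima m x \<Longrightarrow> i < m \<Longrightarrow> x i \<notin> span (x ` {..<i})"
  and minima_le: "minima m x \<Longrightarrow> i < m \<Longrightarrow> g \<in> G \<Longrightarrow> g \<notin> span (x ` {..<i}) \<Longrightarrow> p (x i) \<le> p g"
  by (auto simp: minima_def)

lemma minima_antimono: "minima m x \<Longrightarrow> i \<le> m \<Longrightarrow> minima i x"
  by (auto simp: minima_def)

lemma minima_pos:
  assumes "minima m x" "i < m"
  shows "0 < p (x i)"
proof -
  have "x i \<noteq> 0" using minima_notin[OF assms] span_zero by metis
  then show ?thesis using p_pos minima_mem[OF assms] by blast
qed

lemma minima_mono:
  assumes "minima m x" "i \<le> j" "j < m"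
  shows "p (x i) \<le> p (x j)"
proof -
  have "span (x ` {..<i}) \<subseteq> span (x ` {..<j})"
    using assms by (intro span_mono) auto
  then show ?thesis using assms minima_notin[of m x j] minima_mem[of m x j] minima_le[of m x i "x j"]
    by auto
qed

lemma minima_extend:
  assumes "minima i x" "\<not> G \<subseteq> span (x ` {..<i})"
  shows "\<exists>y. minima (Suc i) (x(i := y))"
proof -
  obtain g where g: "g \<in> G" "g \<notin> span (x ` {..<i})" using assms(2) by auto
  define S where "S = {y \<in> G. p y \<le> p g} - span (x ` {..<i})"
  have "finite S" "S \<noteq> {}" using finite_ball g by (auto simp: S_def)
  then obtain y where y: "y \<in> S" "\<And>u. u \<in> S \<Longrightarrow> p y \<le> p u"
    using ex_is_arg_min_if_finite[of S p] by (metis is_arg_min_linorder)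
  have le: "p y \<le> p u" if "u \<in> G" "u \<notin> span (x ` {..<i})" for u
    using y(2)[of u] y(1) that by (cases "p u \<le> p g") (auto simp: S_def)
  have im: "(x(i := y)) ` {..<j} = x ` {..<j}" if "j \<le> i" for j
    using that by (intro image_cong) auto
  show ?thesis
  proof (rule exI[of _ y], unfold minima_def, intro allI impI)
    fix j assume "j < Suc i"
    then show "(x(i := y)) j \<in> G \<and> (x(i := y)) j \<notin> span ((x(i := y)) ` {..<j}) \<and>
     (\<forall>g\<in>G. g \<notin> span ((x(i := y)) ` {..<j}) \<longrightarrow> p ((x(i := y)) j) \<le> p g)"
      unfolding im[of j, OF Suc_leI[OF \<open>j < Suc i\<close>, simplified]]
      using y le assms(1) by (auto simp: S_def minima_def less_Suc_eq)
  qed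
qed

text \<open>The rank condition speaks of partial sequences so that it can be verified in different
  ways: by dimension for a full lattice, by growth of point counts for an orthogonal
  lattice.\<close>

lemma minima_exists:
  assumes "\<And>i x. i < m \<Longrightarrow> minima i x \<Longrightarrow> \<not> G \<subseteq> span (x ` {..<i})"
  shows "\<exists>x. minima m x"
  using assms
proof (induction m)
  case 0
  then show ?case by (simp add: minima_def)
next
  case (Suc m)
  then obtain x where "minima m x" by auto
  then show ?case using minima_extend[of m x] Suc.prems[of m x] by auto
qed

end

section \<open>Flag bases and point counts in balls\<close>

lemma span_image_comb:
  fixes x :: "nat \<Rightarrow> 'a::euclidean_space"
  assumes "w \<in> span (x ` {..<i})"
  shows "\<exists>c. w = (\<Sum>l<i. c l *\<^sub>R x l)"
  using assms
proof (induction i arbitrary: w)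
  case 0
  then show ?case by simp
next
  case (Suc i)
  have "x ` {..<Suc i} = insert (x i) (x ` {..<i})" by (simp add: lessThan_Suc)
  then obtain k where k: "w - k *\<^sub>R x i \<in> span (x ` {..<i})"
    using Suc.prems span_breakdown_eq by metis
  then obtain c where c: "w - k *\<^sub>R x i = (\<Sum>l<i. c l *\<^sub>R x l)" using Suc.IH by blast
  have "w = (\<Sum>l<Suc i. (c(i := k)) l *\<^sub>R x l)"
    using c by (simp add: algebra_simps)
  then show ?case by blast
qed

lemma comb_in_span:
  fixes x :: "nat \<Rightarrow> 'a::real_vector"
  assumes "\<And>l. l < i \<Longrightarrow> x l \<in> span S"
  shows "(\<Sum>l<i. c l *\<^sub>R x l) \<in> span S"
proof (rule span_sum)
  show "c l *\<^sub>R x l \<in> span S" if "l \<in> {..<i}" for l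
    using assms that span_scale by auto
qed

lemma card_le_fibers:
  assumes "finite P" "\<phi> ` A \<subseteq> P" "\<And>c. c \<in> P \<Longrightarrow> card {a \<in> A. \<phi> a = c} \<le> K"
  shows "card A \<le> card P * K"
proof -
  have "A = (\<Union>c\<in>P. {a \<in> A. \<phi> a = c})" using assms(2) by auto
  then have "card A \<le> (\<Sum>c\<in>P. card {a \<in> A. \<phi> a = c})"
    using card_UN_le[OF assms(1), of "\<lambda>c. {a \<in> A. \<phi> a = c}"] by simp
  also have "\<dots> \<le> card P * K" using sum_bounded_above[of P _ K] assms(3) by simp
  finally show ?thesis .
qed

context normed_subgroup
begin

text \<open>Modulo the old span, the group projects to a line, and the image is generated by its
  least positive element. A short representative exists because subtracting integer multiples of the
  earlier \<open>x l\<close> moves their coefficients into [0, 1) without changing the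
  projection.\<close>

lemma flag_step:
  assumes x: "\<And>l. l \<le> i \<Longrightarrow> x l \<in> G" and ni: "x i \<notin> span (x ` {..<i})"
  shows "\<exists>b. b \<in> G \<and> b \<in> span (x ` {..<Suc i}) \<and> b \<notin> span (x ` {..<i}) \<and>
     p b \<le> (\<Sum>l<Suc i. p (x l)) \<and>
     (\<forall>g\<in>G. g \<in> span (x ` {..<Suc i}) \<longrightarrow> (\<exists>n::int. g - of_int n *\<^sub>R b \<in> span (x ` {..<i})))"
proof -
  let ?W = "span (x ` {..<i})" and ?W' = "span (x ` {..<Suc i})"
  define R where "R = (\<Sum>l<Suc i. p (x l))"
  obtain y z where yz: "y \<in> ?W" "\<And>w. w \<in> ?W \<Longrightarrow> orthogonal z w" "x i = y + z"
    using orthogonal_subspace_decomp_exists[of "x ` {..<i}" "x i"] by metis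
  have z0: "z \<bullet> z \<noteq> 0" using yz ni by auto
  \<comment> \<open>\<open>f\<close> is the coordinate along \<open>x i\<close> modulo the old span:
    it vanishes there and is 1 at \<open>x i\<close>.\<close>
  define f where "f v = (z \<bullet> v) / (z \<bullet> z)" for v
  have f_add: "f (u + v) = f u + f v" and f_diff: "f (u - v) = f u - f v"
    and f_scale: "f (a *\<^sub>R v) = a * f v" for u v a
    by (auto simp: f_def inner_simps add_divide_distrib diff_divide_distrib)
  have fW: "f w = 0" if "w \<in> ?W" for w using yz(2)[OF that] by (simp add: f_def orthogonal_def)
  have fx: "f (x i) = 1" using fW[OF yz(1)] z0 yz(3) by (simp add: f_add) (simp add: f_def)
  have eq: "x ` {..<Suc i} = insert (x i) (x ` {..<i})" by (simp add: lessThan_Suc)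
  have decomp: "v - f v *\<^sub>R x i \<in> ?W" if "v \<in> ?W'" for v
  proof -
    obtain k where k: "v - k *\<^sub>R x i \<in> ?W" using \<open>v \<in> ?W'\<close> span_breakdown_eq eq by metis
    have "f v = k" using fW[OF k] fx by (simp add: f_diff f_scale)
    then show ?thesis using k by simp
  qed
  \<comment> \<open>The ball makes \<open>A\<close> finite, so that \<open>f\<close> attains its
    least value on it.\<close>
  define A where "A = {g \<in> G. p g \<le> R} \<inter> {g \<in> ?W'. 0 < f g}"
  have pxi: "p (x i) \<le> R" unfolding R_def using p_nonneg
    by (simp add: sum_nonneg)
  have "finite A" unfolding A_def using finite_ball by blast
  moreover have "x i \<in> A" using x fx pxi by (auto simp: A_def intro: span_base)
  ultimately obtain b where b: "b \<in> A" "\<And>u. u \<in> A \<Longrightarrow> f b \<le> f u"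
    using ex_is_arg_min_if_finite[of A f] by (metis is_arg_min_linorder empty_iff)
  have fb: "0 < f b" and bG: "b \<in> G" and bW: "b \<in> ?W'" and pb: "p b \<le> R"
    using b(1) by (auto simp: A_def)
  have fb1: "f b \<le> 1" using b(2)[OF \<open>x i \<in> A\<close>] fx by simp
  have "\<exists>n::int. g - of_int n *\<^sub>R b \<in> ?W" if g: "g \<in> G" "g \<in> ?W'" for g
  proof -
    \<comment> \<open>Euclidean division by \<open>b\<close>. A nonzero remainder, once moved into
      the ball, would be an element of \<open>A\<close> with a smaller value of
      \<open>f\<close>.\<close>
    define n where "n = \<lfloor>f g / f b\<rfloor>"
    define h where "h = g - of_int n *\<^sub>R b"
    have hG: "h \<in> G" unfolding h_def using g bG by (intro diff_mem int_scale_mem) auto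
    have hW: "h \<in> ?W'" unfolding h_def using g bW by (intro span_diff span_scale) auto
    have fh: "0 \<le> f h" "f h < f b"
      using floor_divide_lower[OF fb, of "f g"] floor_divide_upper[OF fb, of "f g"]
      by (auto simp: h_def f_diff f_scale n_def algebra_simps)
    have "f h = 0"
    proof (rule ccontr)
      assume "f h \<noteq> 0"
      then have fpos: "0 < f h" using fh by simp
      obtain c where c: "h - f h *\<^sub>R x i = (\<Sum>l<i. c l *\<^sub>R x l)"
        using span_image_comb[OF decomp[OF hW]] by blast
      define s where "s = (\<Sum>l<i. of_int \<lfloor>c l\<rfloor> *\<^sub>R x l)"
      have sG: "s \<in> G" unfolding s_def using x by (intro sum_mem int_scale_mem) auto
      have sW: "s \<in> ?W" unfolding s_def by (intro comb_in_span span_base) auto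
      have sW': "s \<in> ?W'" using sW span_mono[of "x ` {..<i}" "x ` {..<Suc i}"] eq by blast
      have "h - s = f h *\<^sub>R x i + (\<Sum>l<i. (c l - of_int \<lfloor>c l\<rfloor>) *\<^sub>R x l)"
        using c by (simp add: s_def scaleR_left_diff_distrib sum_subtractf algebra_simps)
      then have "p (h - s) \<le> p (f h *\<^sub>R x i) + (\<Sum>l<i. p ((c l - of_int \<lfloor>c l\<rfloor>) *\<^sub>R x l))"
        using p_add[of "f h *\<^sub>R x i" "\<Sum>l<i. (c l - of_int \<lfloor>c l\<rfloor>) *\<^sub>R x l"]
          p_sum[of "\<lambda>l. (c l - of_int \<lfloor>c l\<rfloor>) *\<^sub>R x l" "{..<i}"] by simp
      also have "\<dots> \<le> 1 * p (x i) + (\<Sum>l<i. 1 * p (x l))"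
        unfolding p_scale
      proof (intro add_mono sum_mono mult_right_mono p_nonneg)
        show "\<bar>f h\<bar> \<le> 1" using fh fb1 by simp
        show "\<bar>c l - of_int \<lfloor>c l\<rfloor>\<bar> \<le> 1" for l by linarith
      qed
      also have "\<dots> = R" by (simp add: R_def)
      finally have "p (h - s) \<le> R" .
      moreover have "f (h - s) = f h" using fW[OF sW] by (simp add: f_diff)
      ultimately have "h - s \<in> A" using hG sG hW sW' fpos
        by (auto simp: A_def intro: diff_mem span_diff)
      then show False using b(2)[of "h - s"] fh \<open>f (h - s) = f h\<close> by simp
    qed
    then have "h \<in> ?W" using decomp[OF hW] by simp
    then show ?thesis unfolding h_def by blast
  qed
  moreover have "b \<notin> ?W" using fW[of b] fb by auto
  ultimately show ?thesis using bG bW pb unfolding R_def by blast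
qed

text \<open>Minimal vectors may generate only a proper subgroup of the points in their span. Here
  \<open>b i\<close> generates, modulo the previous span, all of \<open>G\<close> in the span of
  \<open>x 0\<close>, ..., \<open>x i\<close>, at the price of a factor of at most
  \<open>i + 1\<close> in size.\<close>

definition flag_basis :: "nat \<Rightarrow> (nat \<Rightarrow> 'a) \<Rightarrow> (nat \<Rightarrow> 'a) \<Rightarrow> bool" where
  "flag_basis m x b \<longleftrightarrow> (\<forall>i<m. b i \<in> G \<and> b i \<in> span (x ` {..<Suc i}) \<and> b i \<notin> span (x ` {..<i}) \<and>
     p (b i) \<le> (\<Sum>l<Suc i. p (x l)) \<and>
     (\<forall>g\<in>G. g \<in> span (x ` {..<Suc i}) \<longrightarrow> (\<exists>n::int. g - of_int n *\<^sub>R b i \<in> span (x ` {..<i}))))"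

lemma flag_basis_exists:
  assumes "\<And>l. l < m \<Longrightarrow> x l \<in> G" "\<And>l. l < m \<Longrightarrow> x l \<notin> span (x ` {..<l})"
  shows "\<exists>b. flag_basis m x b"
  unfolding flag_basis_def
proof (rule choice, rule allI)
  fix i
  show "\<exists>b. i < m \<longrightarrow> b \<in> G \<and> b \<in> span (x ` {..<Suc i}) \<and> b \<notin> span (x ` {..<i}) \<and>
     p b \<le> (\<Sum>l<Suc i. p (x l)) \<and>
     (\<forall>g\<in>G. g \<in> span (x ` {..<Suc i}) \<longrightarrow> (\<exists>n::int. g - of_int n *\<^sub>R b \<in> span (x ` {..<i})))"
  proof (cases "i < m")
    case True
    then show ?thesis using flag_step[of i x, OF assms(1) assms(2)] by auto
  qed simp
qed

lemma flag_basis_comb: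
  assumes "flag_basis m x b" "i \<le> m" "g \<in> G" "g \<in> span (x ` {..<i})"
  shows "\<exists>c::nat \<Rightarrow> int. g = (\<Sum>l<i. of_int (c l) *\<^sub>R b l)"
  using assms(2-)
proof (induction i arbitrary: g)
  case 0
  then show ?case by simp
next
  case (Suc i)
  then have b: "b i \<in> G" using assms(1) by (auto simp: flag_basis_def)
  obtain n :: int where n: "g - of_int n *\<^sub>R b i \<in> span (x ` {..<i})"
    using Suc assms(1) unfolding flag_basis_def by (metis Suc_le_lessD)
  have "g - of_int n *\<^sub>R b i \<in> G" using Suc.prems b by (intro diff_mem int_scale_mem) auto
  then obtain c :: "nat \<Rightarrow> int" where c: "g - of_int n *\<^sub>R b i = (\<Sum>l<i. of_int (c l) *\<^sub>R b l)"
    using Suc.IH[OF _ _ n] Suc.prems by auto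
  have "g = (\<Sum>l<Suc i. of_int ((c(i := n)) l) *\<^sub>R b l)"
    using c by (simp add: algebra_simps)
  then show ?case by blast
qed

lemma flag_basis_notin:
  assumes "flag_basis m x b" "i < m"
  shows "b i \<notin> span (b ` {..<i})"
proof -
  have "b l \<in> span (x ` {..<i})" if "l < i" for l
  proof -
    have "b l \<in> span (x ` {..<Suc l})" using assms that by (auto simp: flag_basis_def)
    moreover have "span (x ` {..<Suc l}) \<subseteq> span (x ` {..<i})"
      using that by (intro span_mono) auto
    ultimately show ?thesis by blast
  qed
  then have "span (b ` {..<i}) \<subseteq> span (x ` {..<i})"
    by (intro span_minimal subspace_span) auto
  then show ?thesis using assms by (auto simp: flag_basis_def)
qed

text \<open>Points of the ball congruent modulo \<open>t\<close> differ by \<open>t\<close> times a vector shorter than the next minimum.\<close>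

lemma card_ball_step:
  assumes x: "minima m x" "i < m" and t: "2 * \<rho> < real t * p (x i)"
  shows "card {g \<in> G. g \<in> span (x ` {..<Suc i}) \<and> p g \<le> \<rho>}
    \<le> t ^ Suc i * card {g \<in> G. g \<in> span (x ` {..<i}) \<and> p g \<le> p (x i)}"
proof (cases "t = 0")
  case True
  then have "\<rho> < 0" using t by simp
  then have "{g \<in> G. g \<in> span (x ` {..<Suc i}) \<and> p g \<le> \<rho>} = {}"
    using p_nonneg by (auto simp: not_le intro: less_le_trans)
  then show ?thesis by (metis card.empty le0)
next
  case False
  let ?A = "{g \<in> G. g \<in> span (x ` {..<Suc i}) \<and> p g \<le> \<rho>}"
  let ?B = "{g \<in> G. g \<in> span (x ` {..<i}) \<and> p g \<le> p (x i)}"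
  obtain b where b: "flag_basis m x b"
    using flag_basis_exists minima_mem[OF x(1)] minima_notin[OF x(1)] by metis
  have "\<forall>g\<in>?A. \<exists>c::nat \<Rightarrow> int. g = (\<Sum>l<Suc i. of_int (c l) *\<^sub>R b l)"
    using flag_basis_comb[OF b, of "Suc i"] x(2) by auto
  then obtain c :: "'a \<Rightarrow> nat \<Rightarrow> int" where c: "\<And>g. g \<in> ?A \<Longrightarrow> g = (\<Sum>l<Suc i. of_int (c g l) *\<^sub>R b l)"
    by metis
  define \<phi> where "\<phi> g = restrict (\<lambda>l. c g l mod int t) {..<Suc i}" for g
  let ?P = "PiE {..<Suc i} (\<lambda>_. {0..<int t})"
  have "card ?A \<le> card ?P * card ?B"
  proof (rule card_le_fibers)
    show "finite ?P" by (intro finite_PiE) auto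
    show "\<phi> ` ?A \<subseteq> ?P" 
      using False unfolding \<phi>_def by (intro image_subsetI restrict_PiE_iff[THEN iffD2] ballI) simp
    fix q assume "q \<in> ?P"
    show "card {a \<in> ?A. \<phi> a = q} \<le> card ?B"
    proof (cases "{a \<in> ?A. \<phi> a = q} = {}")
      case True
      then show ?thesis by (metis card.empty le0)
    next
      case ne: False
      then obtain y where y: "y \<in> ?A" "\<phi> y = q" by blast
      define h where "h g = (1 / real t) *\<^sub>R (g - y)" for g
      have "inj_on h {a \<in> ?A. \<phi> a = q}" using False by (auto simp: inj_on_def h_def)
      moreover have "h ` {a \<in> ?A. \<phi> a = q} \<subseteq> ?B"
      proof (rule image_subsetI)
        fix g assume "g \<in> {a \<in> ?A. \<phi> a = q}"
        then have g: "g \<in> G" "g \<in> span (x ` {..<Suc i})" "p g \<le> \<rho>" "q = \<phi> g" by auto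
        then have gA: "g \<in> ?A" by auto
        have dv: "int t dvd c g l - c y l" if "l < Suc i" for l
        proof -
          have "\<phi> g l = \<phi> y l" using y g by metis
          then have "c g l mod int t = c y l mod int t" using that by (simp add: \<phi>_def)
          then show ?thesis by (simp add: mod_eq_dvd_iff)
        qed
        define e where "e l = (c g l - c y l) div int t" for l
        have e: "real_of_int (e l) = (of_int (c g l) - of_int (c y l)) / real t" if "l < Suc i" for l
        proof -
          have "c g l - c y l = e l * int t" using dv[OF that] by (simp add: e_def)
          then have "real_of_int (c g l - c y l) = of_int (e l) * real t" by simp
          then show ?thesis using False by (simp add: field_simps)
        qed
        have "h g = (1 / real t) *\<^sub>R (\<Sum>l<Suc i. (of_int (c g l) - of_int (c y l)) *\<^sub>R b l)"
          using c[OF gA] c[OF y(1)] unfolding h_def scaleR_left_diff_distrib sum_subtractf by metis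
        also have "\<dots> = (\<Sum>l<Suc i. of_int (e l) *\<^sub>R b l)"
          unfolding scaleR_sum_right by (intro sum.cong) (auto simp: e)
        finally have he: "h g = (\<Sum>l<Suc i. of_int (e l) *\<^sub>R b l)" .
        have hG: "h g \<in> G" unfolding he using b x(2)
          by (intro sum_mem int_scale_mem) (auto simp: flag_basis_def)
        have "p (h g) = p (g - y) / real t" by (simp add: h_def p_scale)
        also have "\<dots> \<le> 2 * \<rho> / real t"
          using p_diff[of g y] g y by (intro divide_right_mono) auto
        also have "\<dots> < p (x i)" using t False by (simp add: field_simps)
        finally have lt: "p (h g) < p (x i)" .
        moreover have "h g \<in> span (x ` {..<i})" using minima_le[OF x hG] lt by fastforce
        ultimately show "h g \<in> ?B" using hG by simp
      qed
      moreover have "finite ?B" using finite_ball[of "p (x i)"] by (rule rev_finite_subset) auto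
      ultimately show ?thesis by (intro card_inj_on_le)
    qed
  qed
  then show ?thesis by (simp add: card_PiE)
qed

text \<open>A counting substitute for Minkowski's second theorem. The modulus \<open>t\<close> is
  the least integer above \<open>2 * \<rho> / \<mu>\<close>, at most
  \<open>3 * \<rho> / \<mu>\<close> since \<open>\<mu> \<le> \<rho>\<close>. The induction
  hypothesis is applied at radius \<open>\<mu>\<close>, not \<open>\<rho>\<close>; this is why
  \<open>\<rho>\<close> is generalised and why the power \<open>t ^ Suc i\<close> gives the right
  order: its denominator cancels \<open>\<mu> ^ i\<close>.\<close>

lemma card_ball_span_le:
  assumes "minima m x" "i \<le> m" "\<And>l. l < i \<Longrightarrow> p (x l) \<le> \<rho>" "0 \<le> \<rho>"
  shows "real (card {g \<in> G. g \<in> span (x ` {..<i}) \<and> p g \<le> \<rho>})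
     \<le> 3 ^ (i * i) * \<rho> ^ i / (\<Prod>l<i. p (x l))"
  using assms(2-)
proof (induction i arbitrary: \<rho>)
  case 0
  have "{g \<in> G. g \<in> span (x ` {..<0}) \<and> p g \<le> \<rho>} = {0}" using 0 zero_mem by auto
  then have "card {g \<in> G. g \<in> span (x ` {..<0}) \<and> p g \<le> \<rho>} = 1" by (metis card_1_singleton_iff One_nat_def)
  then show ?case by simp
next
  case (Suc i)
  define \<mu> where "\<mu> = p (x i)"
  have im: "i < m" using Suc by simp
  have \<mu>: "0 < \<mu>" "\<mu> \<le> \<rho>" using minima_pos[OF assms(1) im] Suc.prems by (auto simp: \<mu>_def)
  have Ppos: "0 < (\<Prod>l<i. p (x l))" using minima_pos[OF assms(1)] im by (intro prod_pos) auto
  define t where "t = nat \<lfloor>2 * \<rho> / \<mu>\<rfloor> + 1"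
  have q1: "1 \<le> \<rho> / \<mu>" using \<mu> by simp
  have t1: "2 * \<rho> / \<mu> < real t" using q1 by (simp add: t_def) linarith
  have t2: "real t \<le> 3 * \<rho> / \<mu>" using q1 by (simp add: t_def) linarith
  have "real (card {g \<in> G. g \<in> span (x ` {..<Suc i}) \<and> p g \<le> \<rho>})
     \<le> real (t ^ Suc i * card {g \<in> G. g \<in> span (x ` {..<i}) \<and> p g \<le> \<mu>})"
    using card_ball_step[OF assms(1) im, of \<rho> t] t1 \<mu>
    by (intro of_nat_mono) (simp add: \<mu>_def field_simps)
  also have "\<dots> = real t ^ Suc i * real (card {g \<in> G. g \<in> span (x ` {..<i}) \<and> p g \<le> \<mu>})"
    by simp
  also have "\<dots> \<le> (3 * \<rho> / \<mu>) ^ Suc i * (3 ^ (i * i) * \<mu> ^ i / (\<Prod>l<i. p (x l)))"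
    using Suc.IH[of \<mu>] im \<mu> t2 minima_mono[OF assms(1), of _ i]
    by (intro mult_mono power_mono) (auto simp: \<mu>_def)
  also have "\<dots> = 3 ^ (i * i + i + 1) * \<rho> ^ Suc i / (\<Prod>l<Suc i. p (x l))"
    using \<mu> Ppos by (simp add: power_add power_divide power_mult_distrib \<mu>_def field_simps)
  also have "\<dots> \<le> 3 ^ (Suc i * Suc i) * \<rho> ^ Suc i / (\<Prod>l<Suc i. p (x l))"
    using \<mu> Ppos
    by (intro divide_right_mono mult_right_mono power_increasing) (auto simp: \<mu>_def)
  finally show ?case .
qed

end

section \<open>Successive minima of a lattice\<close>

text \<open>The Minkowski functional. For a symmetric convex body it is a norm whose balls of radius
  \<open>t > 0\<close> are the dilates of \<open>K\<close>, which turns \<open>succ_min\<close> into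
  the minima of a normed subgroup.\<close>

definition gauge_fun :: "'a::euclidean_space set \<Rightarrow> 'a \<Rightarrow> real" where
  "gauge_fun K v = Inf {t. 0 < t \<and> inverse t *\<^sub>R v \<in> K}"

lemma mem_scaled_iff:
  fixes v :: "'a::real_vector"
  assumes "0 < t"
  shows "v \<in> (*\<^sub>R) t ` K \<longleftrightarrow> inverse t *\<^sub>R v \<in> K"
proof
  assume "v \<in> (*\<^sub>R) t ` K"
  then show "inverse t *\<^sub>R v \<in> K" using assms by auto
next
  assume "inverse t *\<^sub>R v \<in> K"
  moreover have "v = t *\<^sub>R (inverse t *\<^sub>R v)" using assms by simp
  ultimately show "v \<in> (*\<^sub>R) t ` K" by (metis imageI)
qed

lemma sym_convex_body_ball:
  fixes K :: "'a::euclidean_space set"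
  assumes "sym_convex_body K"
  obtains e where "0 < e" "ball 0 e \<subseteq> K"
proof -
  have K: "convex K" "aff_dim K = int DIM('a)" "uminus ` K = K"
    using assms by (auto simp: sym_convex_body_def)
  have "affine hull K = UNIV" using K(2) aff_dim_eq_full by blast
  then have "rel_interior K = interior K" by (rule rel_interior_interior)
  moreover have "K \<noteq> {}" using K(2) by auto
  ultimately have "interior K \<noteq> {}" using rel_interior_eq_empty[OF K(1)] by simp
  then obtain x e where e: "0 < e" "ball x e \<subseteq> K" by (auto simp: mem_interior)
  have "u \<in> K" if "u \<in> ball 0 (e / 2)" for u
  proof -
    \<comment> \<open>\<open>u\<close> is the midpoint of \<open>x + 2 u\<close> and
      \<open>- x\<close>, and both lie in \<open>K\<close>.\<close>
    have "x + 2 *\<^sub>R u \<in> K" using that e by (intro subsetD[OF e(2)]) (auto simp: dist_norm)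
    moreover have "x \<in> K" using e by auto
    then have "- x \<in> K" using K(3) by blast
    ultimately have "(1/2) *\<^sub>R (x + 2 *\<^sub>R u) + (1/2) *\<^sub>R (- x) \<in> K"
      using K(1) by (intro convexD) auto
    then show ?thesis by (simp add: scaleR_add_right)
  qed
  then have "ball 0 (e / 2) \<subseteq> K" by blast
  then show thesis using that[of "e / 2"] e(1) by simp
qed

context
  fixes K :: "'a::euclidean_space set"
  assumes K: "sym_convex_body K"
begin

lemma body_zero: "0 \<in> K"
proof -
  obtain e where "0 < e" "ball 0 e \<subseteq> K" using sym_convex_body_ball[OF K] .
  then show ?thesis by auto
qed

lemma body_minus: "v \<in> K \<Longrightarrow> - v \<in> K"
  using K by (auto simp: sym_convex_body_def)

lemma body_scale_mono:
  assumes "inverse t *\<^sub>R v \<in> K" "0 < t" "t \<le> s"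
  shows "inverse s *\<^sub>R v \<in> K"
proof -
  have "convex K" using K by (simp add: sym_convex_body_def)
  then have "(t / s) *\<^sub>R (inverse t *\<^sub>R v) + (1 - t / s) *\<^sub>R 0 \<in> K"
    using assms body_zero by (intro convexD) auto
  moreover have "(t / s) * inverse t = inverse s" using assms by (simp add: field_simps)
  ultimately show ?thesis by simp
qed

lemma gauge_fun_set_nonempty: "{t. 0 < t \<and> inverse t *\<^sub>R v \<in> K} \<noteq> {}"
proof -
  obtain e where e: "0 < e" "ball 0 e \<subseteq> K" using sym_convex_body_ball[OF K] .
  define t where "t = norm v / e + 1"
  have t: "0 < t" using e by (simp add: t_def add_nonneg_pos)
  have "norm v < t * e" using e by (simp add: t_def field_simps)
  then have "inverse t *\<^sub>R v \<in> ball 0 e" using t by (simp add: field_simps)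
  then show ?thesis using t e by blast
qed

lemma gauge_fun_bdd: "bdd_below {t. 0 < t \<and> inverse t *\<^sub>R v \<in> K}"
  by (intro bdd_belowI[of _ 0]) auto

lemma gauge_fun_nonneg: "0 \<le> gauge_fun K v"
  unfolding gauge_fun_def using gauge_fun_set_nonempty by (intro cInf_greatest) auto

text \<open>The infimum is attained because \<open>K\<close> is closed. Positivity of
  \<open>t\<close> is essential: since \<open>inverse 0 = 0\<close>, the right side would hold for
  every \<open>v\<close> at \<open>t = 0\<close>.\<close>

lemma gauge_fun_le_iff:
  assumes "0 < t"
  shows "gauge_fun K v \<le> t \<longleftrightarrow> inverse t *\<^sub>R v \<in> K"
proof
  assume "inverse t *\<^sub>R v \<in> K"
  then show "gauge_fun K v \<le> t"
    unfolding gauge_fun_def using assms gauge_fun_bdd by (intro cInf_lower) auto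
next
  assume le: "gauge_fun K v \<le> t"
  have mem: "inverse s *\<^sub>R v \<in> K" if "t < s" for s
  proof -
    have "Inf {t. 0 < t \<and> inverse t *\<^sub>R v \<in> K} < s" using le that by (simp add: gauge_fun_def)
    then obtain u where "0 < u" "inverse u *\<^sub>R v \<in> K" "u < s"
      using cInf_lessD[OF gauge_fun_set_nonempty[of v]] by blast
    then show ?thesis using body_scale_mono[of u v s] by simp
  qed
  have "closed K" using K by (simp add: sym_convex_body_def compact_imp_closed)
  moreover have "inverse (t + inverse (real (Suc n))) *\<^sub>R v \<in> K" for n
    by (rule mem) simp
  moreover have "(\<lambda>n. inverse (t + inverse (real (Suc n))) *\<^sub>R v) \<longlonglongrightarrow> inverse (t + 0) *\<^sub>R v"
    using assms by (intro tendsto_intros LIMSEQ_inverse_real_of_nat) auto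
  ultimately have "inverse (t + 0) *\<^sub>R v \<in> K" by (rule closed_sequentially)
  then show "inverse t *\<^sub>R v \<in> K" by simp
qed

lemma gauge_fun_add: "gauge_fun K (v + w) \<le> gauge_fun K v + gauge_fun K w"
proof (rule field_le_epsilon)
  fix e :: real assume e: "0 < e"
  define a b where "a = gauge_fun K v + e / 2" and "b = gauge_fun K w + e / 2"
  have ab: "0 < a" "0 < b" using e gauge_fun_nonneg by (auto simp: a_def b_def add_nonneg_pos)
  have "inverse a *\<^sub>R v \<in> K" "inverse b *\<^sub>R w \<in> K"
    using e ab by (auto simp: gauge_fun_le_iff[symmetric]) (auto simp: a_def b_def)
  then have "(a / (a + b)) *\<^sub>R (inverse a *\<^sub>R v) + (b / (a + b)) *\<^sub>R (inverse b *\<^sub>R w) \<in> K"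
    using K ab by (intro convexD) (auto simp: sym_convex_body_def add_divide_distrib[symmetric])
  then have "inverse (a + b) *\<^sub>R (v + w) \<in> K"
    using ab by (simp add: scaleR_add_right field_simps)
  then have "gauge_fun K (v + w) \<le> a + b" using ab by (simp add: gauge_fun_le_iff)
  then show "gauge_fun K (v + w) \<le> gauge_fun K v + gauge_fun K w + e" by (simp add: a_def b_def)
qed

lemma gauge_fun_scale: "gauge_fun K (a *\<^sub>R v) = \<bar>a\<bar> * gauge_fun K v"
proof -
  \<comment> \<open>Only positive thresholds are available from \<open>gauge_fun_le_iff\<close>.
    They suffice, because the midpoint of two distinct nonnegative reals is positive and separates
    them.\<close>
  have eqI: "u = w" if "0 \<le> u" "0 \<le> w" "\<And>t. 0 < t \<Longrightarrow> u \<le> t \<longleftrightarrow> w \<le> t" for u w :: real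
  proof (rule ccontr)
    assume "u \<noteq> w"
    then have lt: "u < w \<or> w < u" by auto
    then have "0 < (u + w) / 2" using that(1,2) by auto
    then show False using that(3)[of "(u + w) / 2"] lt by auto
  qed
  show ?thesis
  proof (cases "a = 0")
    case True
    have "gauge_fun K 0 = 0"
      by (rule eqI) (auto simp: gauge_fun_nonneg gauge_fun_le_iff body_zero)
    then show ?thesis using True by simp
  next
    case False
    show ?thesis
    proof (rule eqI)
      fix t :: real assume t: "0 < t"
      have "inverse t *\<^sub>R (a *\<^sub>R v) \<in> K \<longleftrightarrow> inverse (t / \<bar>a\<bar>) *\<^sub>R v \<in> K"
      proof (cases "0 \<le> a")
        case True
        then show ?thesis by (simp add: field_simps)
      next
        case neg: False
        then have "inverse t *\<^sub>R (a *\<^sub>R v) = - (inverse (t / \<bar>a\<bar>) *\<^sub>R v)"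
          by (simp add: field_simps)
        then show ?thesis using body_minus by (metis minus_minus)
      qed
      moreover have "0 < t / \<bar>a\<bar>" using t False by simp
      ultimately have "gauge_fun K (a *\<^sub>R v) \<le> t \<longleftrightarrow> gauge_fun K v \<le> t / \<bar>a\<bar>"
        using t by (simp add: gauge_fun_le_iff)
      then show "gauge_fun K (a *\<^sub>R v) \<le> t \<longleftrightarrow> \<bar>a\<bar> * gauge_fun K v \<le> t"
        using False by (simp add: field_simps)
    qed (auto simp: gauge_fun_nonneg)
  qed
qed

lemma gauge_fun_ball_bounded: "bounded {v. gauge_fun K v \<le> \<rho>}"
proof -
  have "{v. gauge_fun K v \<le> \<rho>} \<subseteq> (*\<^sub>R) (max \<rho> 1) ` K"
  proof
    fix v assume "v \<in> {v. gauge_fun K v \<le> \<rho>}"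
    then have "gauge_fun K v \<le> max \<rho> 1" by simp
    then have "inverse (max \<rho> 1) *\<^sub>R v \<in> K" using gauge_fun_le_iff[of "max \<rho> 1" v] by simp
    then show "v \<in> (*\<^sub>R) (max \<rho> 1) ` K" using mem_scaled_iff[of "max \<rho> 1" v K] by simp
  qed
  moreover have "bounded ((*\<^sub>R) (max \<rho> 1) ` K)"
    using K by (intro bounded_scaling compact_imp_bounded) (auto simp: sym_convex_body_def)
  ultimately show ?thesis using bounded_subset by blast
qed

end

section \<open>Lattices as discrete subgroups\<close>

lemma is_lattice_seq:
  fixes L :: "'a::euclidean_space set"
  assumes "is_lattice L"
  obtains f where "\<And>i. i < DIM('a) \<Longrightarrow> f i \<notin> span (f ` {..<i})"
    "L = range (\<lambda>c::nat \<Rightarrow> int. \<Sum>l<DIM('a). of_int (c l) *\<^sub>R f l)"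
proof -
  obtain B where B: "independent B" "card B = DIM('a)"
      "L = {\<Sum>b\<in>B. c b *\<^sub>R b | c. \<forall>b\<in>B. c b \<in> \<int>}"
    using assms by (auto simp: is_lattice_def)
  have "finite B" using B(1) by (rule independent_imp_finite)
  then obtain f where f: "bij_betw f {..<DIM('a)} B"
    using ex_bij_betw_nat_finite[of B] B(2) by (auto simp: atLeast0LessThan)
  have "f i \<notin> span (f ` {..<i})" if "i < DIM('a)" for i
  proof -
    have "f ` {..<i} \<subseteq> B - {f i}"
      using f that by (auto simp: bij_betw_def inj_on_def)
    then have "span (f ` {..<i}) \<subseteq> span (B - {f i})" by (rule span_mono)
    moreover have "f i \<in> B" using f that by (auto simp: bij_betw_def)
    ultimately show ?thesis using B(1) unfolding dependent_def by blast
  qed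
  moreover have "L = range (\<lambda>c::nat \<Rightarrow> int. \<Sum>l<DIM('a). of_int (c l) *\<^sub>R f l)"
  proof (intro set_eqI iffI)
    fix v assume "v \<in> L"
    then obtain c where c: "v = (\<Sum>b\<in>B. c b *\<^sub>R b)" "\<forall>b\<in>B. c b \<in> \<int>" using B(3) by auto
    have "v = (\<Sum>l<DIM('a). c (f l) *\<^sub>R f l)"
      unfolding c(1) using sum.reindex_bij_betw[OF f, of "\<lambda>b. c b *\<^sub>R b"] by simp
    also have "\<dots> = (\<Sum>l<DIM('a). of_int \<lfloor>c (f l)\<rfloor> *\<^sub>R f l)"
      using c(2) f by (intro sum.cong) (auto simp: bij_betw_def)
    finally show "v \<in> range (\<lambda>c::nat \<Rightarrow> int. \<Sum>l<DIM('a). of_int (c l) *\<^sub>R f l)"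
      by (rule range_eqI[of _ _ "\<lambda>l. \<lfloor>c (f l)\<rfloor>"])
  next
    fix v assume "v \<in> range (\<lambda>c::nat \<Rightarrow> int. \<Sum>l<DIM('a). of_int (c l) *\<^sub>R f l)"
    then obtain c :: "nat \<Rightarrow> int" where c: "v = (\<Sum>l<DIM('a). of_int (c l) *\<^sub>R f l)" by blast
    define g where "g = the_inv_into {..<DIM('a)} f"
    have "v = (\<Sum>l<DIM('a). of_int (c (g (f l))) *\<^sub>R f l)"
      unfolding c using f by (intro sum.cong) (auto simp: g_def bij_betw_def the_inv_into_f_f)
    also have "\<dots> = (\<Sum>b\<in>B. of_int (c (g b)) *\<^sub>R b)"
      by (rule sum.reindex_bij_betw[OF f])
    finally have "v = (\<Sum>b\<in>B. of_int (c (g b)) *\<^sub>R b)" .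
    then show "v \<in> L" unfolding B(3)
      by (intro CollectI exI[of _ "\<lambda>b. of_int (c (g b))"]) auto
  qed
  ultimately show thesis using that by blast
qed

lemma finite_int_comb_bounded:
  fixes f :: "nat \<Rightarrow> 'a::euclidean_space"
  assumes f: "\<And>i. i < m \<Longrightarrow> f i \<notin> span (f ` {..<i})" and S: "bounded S"
  shows "finite (S \<inter> range (\<lambda>c::nat \<Rightarrow> int. \<Sum>l<m. of_int (c l) *\<^sub>R f l))"
proof -
  obtain y where y: "\<And>i j. i < m \<Longrightarrow> j < m \<Longrightarrow> y i \<bullet> f j = (if i = j then 1 else 0)"
    using dual_seq[of m f] f by metis
  obtain R where R: "\<And>v. v \<in> S \<Longrightarrow> norm v \<le> R" using S by (auto simp: bounded_iff)
  define N where "N l = \<lceil>\<bar>R\<bar> * norm (y l)\<rceil>" for l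
  have "S \<inter> range (\<lambda>c::nat \<Rightarrow> int. \<Sum>l<m. of_int (c l) *\<^sub>R f l)
     \<subseteq> (\<lambda>c. \<Sum>l<m. of_int (c l) *\<^sub>R f l) ` PiE {..<m} (\<lambda>l. {- N l..N l})"
  proof clarify
    fix c :: "nat \<Rightarrow> int" assume "(\<Sum>l<m. of_int (c l) *\<^sub>R f l) \<in> S"
    then have R': "norm (\<Sum>l<m. of_int (c l) *\<^sub>R f l) \<le> \<bar>R\<bar>" using R by fastforce
    have "\<bar>c j\<bar> \<le> N j" if "j < m" for j
    proof -
      have "(\<Sum>l<m. of_int (c l) *\<^sub>R f l) \<bullet> y j = of_int (c j)"
        using that y by (intro inner_comb_dual) (auto simp: inner_commute)
      then have "\<bar>of_int (c j)\<bar> \<le> norm (\<Sum>l<m. of_int (c l) *\<^sub>R f l) * norm (y j)"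
        using Cauchy_Schwarz_ineq2 by metis
      also have "\<dots> \<le> \<bar>R\<bar> * norm (y j)" using R' by (intro mult_right_mono) auto
      finally show ?thesis unfolding N_def by linarith
    qed
    then have "restrict c {..<m} \<in> PiE {..<m} (\<lambda>l. {- N l..N l})"
      by (auto simp: abs_le_iff minus_le_iff)
    moreover have "(\<Sum>l<m. of_int (c l) *\<^sub>R f l) = (\<Sum>l<m. of_int (restrict c {..<m} l) *\<^sub>R f l)"
      by (intro sum.cong) auto
    ultimately show "(\<Sum>l<m. of_int (c l) *\<^sub>R f l)
       \<in> (\<lambda>c. \<Sum>l<m. of_int (c l) *\<^sub>R f l) ` PiE {..<m} (\<lambda>l. {- N l..N l})"
      by (intro image_eqI[of _ _ "restrict c {..<m}"])
  qed
  moreover have "finite \<dots>" by (intro finite_imageI finite_PiE) auto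
  ultimately show ?thesis by (rule finite_subset)
qed

lemma int_comb_diff:
  fixes f :: "nat \<Rightarrow> 'a::real_vector"
  assumes "x \<in> range (\<lambda>c::nat \<Rightarrow> int. \<Sum>l<m. of_int (c l) *\<^sub>R f l)"
    and "y \<in> range (\<lambda>c::nat \<Rightarrow> int. \<Sum>l<m. of_int (c l) *\<^sub>R f l)"
  shows "x - y \<in> range (\<lambda>c::nat \<Rightarrow> int. \<Sum>l<m. of_int (c l) *\<^sub>R f l)"
proof -
  obtain c c' :: "nat \<Rightarrow> int" where "x = (\<Sum>l<m. of_int (c l) *\<^sub>R f l)"
      "y = (\<Sum>l<m. of_int (c' l) *\<^sub>R f l)" using assms by auto
  then have "x - y = (\<Sum>l<m. of_int (c l - c' l) *\<^sub>R f l)"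
    by (simp add: sum_subtractf scaleR_left_diff_distrib)
  then show ?thesis by (rule range_eqI[of _ _ "\<lambda>l. c l - c' l"])
qed

lemma lattice_normed_subgroup:
  fixes L :: "'a::euclidean_space set"
  assumes "is_lattice L" "sym_convex_body K"
  shows "normed_subgroup L (gauge_fun K)"
proof -
  obtain f where f: "\<And>i. i < DIM('a) \<Longrightarrow> f i \<notin> span (f ` {..<i})"
    "L = range (\<lambda>c::nat \<Rightarrow> int. \<Sum>l<DIM('a). of_int (c l) *\<^sub>R f l)"
    using is_lattice_seq[OF assms(1)] by blast
  show ?thesis
  proof
    show "0 \<in> L" unfolding f(2) by (rule range_eqI[of _ _ "\<lambda>_. 0"]) simp
    show "x - y \<in> L" if "x \<in> L" "y \<in> L" for x y using int_comb_diff that unfolding f(2) .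
    show "finite {x \<in> L. gauge_fun K x \<le> \<rho>}" for \<rho>
      using finite_int_comb_bounded[OF f(1) gauge_fun_ball_bounded[OF assms(2), of \<rho>], of "DIM('a)"]
      unfolding f(2)[symmetric] by (simp add: Collect_conj_eq Int_commute)
  qed (use gauge_fun_add[OF assms(2)] gauge_fun_scale[OF assms(2)] in auto)
qed

lemma lattice_minima_exists:
  fixes L :: "'a::euclidean_space set"
  assumes "is_lattice L" "sym_convex_body K"
  shows "\<exists>x. normed_subgroup.minima L (gauge_fun K) DIM('a) x"
proof -
  interpret normed_subgroup L "gauge_fun K" using lattice_normed_subgroup[OF assms] .
  obtain f where f: "\<And>i. i < DIM('a) \<Longrightarrow> f i \<notin> span (f ` {..<i})"
    "L = range (\<lambda>c::nat \<Rightarrow> int. \<Sum>l<DIM('a). of_int (c l) *\<^sub>R f l)"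
    using is_lattice_seq[OF assms(1)] by blast
  have fL: "f i \<in> L" if "i < DIM('a)" for i
    unfolding f(2) using that
    by (intro range_eqI[of _ _ "\<lambda>l. if l = i then 1 else 0"])
      (simp add: if_distrib[of real_of_int] if_distrib[of "\<lambda>c. c *\<^sub>R _"] cong: if_cong)
  show ?thesis
  proof (rule minima_exists)
    fix i x assume i: "i < DIM('a)"
    show "\<not> L \<subseteq> span (x ` {..<i})"
    proof
      assume "L \<subseteq> span (x ` {..<i})"
      then have "f ` {..<DIM('a)} \<subseteq> span (x ` {..<i})" using fL by auto
      moreover have "independent (f ` {..<DIM('a)})" "card (f ` {..<DIM('a)}) = DIM('a)"
        using seq_independent[OF f(1), of "DIM('a)"] by (auto simp: card_image)
      ultimately have "DIM('a) \<le> card (x ` {..<i})"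
        using independent_span_bound[of "x ` {..<i}" "f ` {..<DIM('a)}"] by auto
      then show False using card_image_le[of "{..<i}" x] i by simp
    qed
  qed
qed

text \<open>The admissible factors form the ray that starts at \<open>gauge_fun K (x i)\<close>: for
  smaller factors all available points lie in the span of \<open>i\<close> vectors, from there on
  \<open>x 0\<close>, ..., \<open>x i\<close> are available. Affine dimension is linear dimension
  here, since 0 is always available. The \<open>Suc\<close> converts between minima numbered from 1
  and vectors numbered from 0.\<close>

lemma succ_min_eq:
  fixes L :: "'a::euclidean_space set"
  assumes L: "is_lattice L" and K: "sym_convex_body K"
    and x: "normed_subgroup.minima L (gauge_fun K) DIM('a) x" and i: "i < DIM('a)"
  shows "succ_min L K (Suc i) = gauge_fun K (x i)"
proof -
  interpret normed_subgroup L "gauge_fun K" using lattice_normed_subgroup[OF L K] .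
  define S where "S r = {v \<in> L. gauge_fun K v \<le> r}" for r
  have S: "L \<inter> (*\<^sub>R) r ` K = S r" if "0 < r" for r
    using mem_scaled_iff[OF that, of _ K] gauge_fun_le_iff[OF K that] by (auto simp: S_def)
  have "int (Suc i) \<le> aff_dim (S r) \<longleftrightarrow> gauge_fun K (x i) \<le> r" if r: "0 < r" for r
  proof
    assume le: "int (Suc i) \<le> aff_dim (S r)"
    show "gauge_fun K (x i) \<le> r"
    proof (rule ccontr)
      assume "\<not> gauge_fun K (x i) \<le> r"
      then have "S r \<subseteq> span (x ` {..<i})"
        using minima_le[OF x i] by (fastforce simp: S_def)
      then have "aff_dim (S r) \<le> int (dim (span (x ` {..<i})))"
        using aff_dim_subset aff_dim_subspace[OF subspace_span] by metis
      also have "\<dots> \<le> int i"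
        using dim_le_card'[of "x ` {..<i}"] card_image_le[of "{..<i}" x] by simp
      finally show False using le by simp
    qed
  next
    assume le: "gauge_fun K (x i) \<le> r"
    have "0 \<in> S r" using r zero_mem by (simp add: S_def)
    then have "aff_dim (S r) = int (dim (S r))" by (intro aff_dim_zero hull_inc)
    moreover have "x ` {..<Suc i} \<subseteq> S r"
      using minima_mem[OF x] minima_mono[OF x] le i by (fastforce simp: S_def less_Suc_eq_le)
    moreover have "inj_on x {..<Suc i}" "independent (x ` {..<Suc i})"
      using seq_independent[of "Suc i" x] minima_notin[OF x] i by auto
    ultimately show "int (Suc i) \<le> aff_dim (S r)"
      using independent_card_le_dim[of "x ` {..<Suc i}" "S r"] by (simp add: card_image)
  qed
  moreover have "0 < gauge_fun K (x i)" using minima_pos[OF x i] .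
  ultimately have "{r. 0 < r \<and> int (Suc i) \<le> aff_dim (L \<inter> (*\<^sub>R) r ` K)} = {gauge_fun K (x i)..}"
    by (auto simp: S less_le_trans)
  then show ?thesis by (simp add: succ_min_def cInf_atLeast)
qed

section \<open>Coordinates of short vectors in a flag basis\<close>

context normed_subgroup
begin

text \<open>If the \<open>i\<close>-th coordinate of \<open>z\<close> is large, rounding the multiples \<open>t z\<close>, \<open>0 \<le> t \<le> 1\<close>, to lattice points
and adding a box in the other coordinates gives too many points in a ball.\<close>

lemma flag_coordinate_bound:
  assumes x: "minima m x" and b: "flag_basis m x b" and small: "\<And>l. l < m \<Longrightarrow> p (x l) \<le> 1"
    and z: "z \<in> G" "p z \<le> 1" "z = (\<Sum>l<m. of_int (c l) *\<^sub>R b l)" and i: "i < m"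
  shows "\<bar>real_of_int (c i)\<bar> * p (x i) \<le> 3 ^ (m * m) * (1 + 2 * real (m * m)) ^ m"
proof (cases "c i = 0")
  case True
  then show ?thesis by simp
next
  case False
  define \<mu> where "\<mu> l = p (x l)" for l
  have \<mu>: "0 < \<mu> l" "\<mu> l \<le> 1" if "l < m" for l
    using minima_pos[OF x that] small[OF that] by (auto simp: \<mu>_def)
  define T where "T = \<bar>c i\<bar>"
  have T: "0 < T" using False by (simp add: T_def)
  \<comment> \<open>The 1 bounds the size of \<open>t z\<close>. Each of the \<open>m\<close>
    coordinates is off by at most \<open>2 / \<mu> l\<close>, and
    \<open>p (b l) \<le> m * \<mu> l\<close>, which adds \<open>2 * m\<close> per
    coordinate.\<close>
  define \<rho> where "\<rho> = 1 + 2 * real (m * m)"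
  define A where "A l = (if l = i then {0..T} else {0..\<lfloor>1 / \<mu> l\<rfloor>})" for l
  define k where "k e l = (if l = i then 0 else e l) + \<lfloor>of_int (e i) * of_int (c l) / real_of_int T\<rfloor>"
    for e :: "nat \<Rightarrow> int" and l
  define \<psi> where "\<psi> e = (\<Sum>l<m. of_int (k e l) *\<^sub>R b l)" for e
  have pb: "p (b l) \<le> real m * \<mu> l" if "l < m" for l
  proof -
    have "p (b l) \<le> (\<Sum>j<Suc l. p (x j))" using b that by (auto simp: flag_basis_def)
    also have "\<dots> \<le> (\<Sum>j<Suc l. \<mu> l)"
      using minima_mono[OF x] that by (intro sum_mono) (auto simp: \<mu>_def)
    also have "\<dots> \<le> real m * \<mu> l" using that \<mu>[of l] by (auto intro!: mult_right_mono)
    finally show ?thesis .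
  qed
  have bG: "b l \<in> G" "b l \<in> span (x ` {..<m})" if "l < m" for l
  proof -
    have "span (x ` {..<Suc l}) \<subseteq> span (x ` {..<m})" using that by (intro span_mono image_mono) auto
    then show "b l \<in> G" "b l \<in> span (x ` {..<m})" using b that by (auto simp: flag_basis_def)
  qed
  \<comment> \<open>At index \<open>i\<close> the multiple of \<open>z\<close> has an exact integer
    coordinate and no offset is added, so \<open>e i\<close> can be recovered from the point, and
    then the offsets as well.\<close>
  have kei: "k e i = e i * sgn (c i)" for e
  proof -
    have "of_int (e i) * of_int (c i) / real_of_int T = of_int (e i * sgn (c i))"
      using False by (simp add: T_def sgn_if)
    then show ?thesis unfolding k_def by (simp only: floor_of_int simp_thms if_True add_0)
  qed
  have inj: "inj_on \<psi> (PiE {..<m} A)"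
  proof (rule inj_onI)
    fix e e' assume e: "e \<in> PiE {..<m} A" "e' \<in> PiE {..<m} A" and eq: "\<psi> e = \<psi> e'"
    have keq: "k e l = k e' l" if "l < m" for l
    proof -
      have "real_of_int (k e l) = real_of_int (k e' l)"
        by (rule comb_inj[OF flag_basis_notin[OF b], where c = "\<lambda>l. of_int (k e l)" and c' = "\<lambda>l. of_int (k e' l)"])
          (use eq that in \<open>simp_all add: \<psi>_def\<close>)
      then show ?thesis by simp
    qed
    have ei: "e i = e' i" using keq[OF i] False by (simp add: kei sgn_0_0)
    have "e l = e' l" if "l < m" for l
      using keq[OF that] ei by (cases "l = i") (auto simp: k_def)
    then show "e = e'" using e by (intro PiE_ext) auto
  qed
  have into: "\<psi> e \<in> {g \<in> G. g \<in> span (x ` {..<m}) \<and> p g \<le> \<rho>}" if e: "e \<in> PiE {..<m} A" for e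
  proof -
    define t where "t = of_int (e i) / real_of_int T"
    have "e i \<in> {0..T}" using e i by (auto simp: A_def PiE_iff split: if_splits)
    then have t: "0 \<le> t" "t \<le> 1" using T by (auto simp: t_def)
    have \<psi>: "\<psi> e = t *\<^sub>R z + (\<Sum>l<m. (of_int (k e l) - t * of_int (c l)) *\<^sub>R b l)"
      unfolding z(3) \<psi>_def by (simp add: scaleR_sum_right scaleR_left_diff_distrib sum_subtractf)
    have \<delta>: "\<bar>of_int (k e l) - t * of_int (c l)\<bar> * \<mu> l \<le> 2" if l: "l < m" for l
    proof -
      have "real_of_int (if l = i then 0 else e l) \<le> 1 / \<mu> l \<and> 0 \<le> (if l = i then 0 else e l)"
      proof (cases "l = i")
        case False
        then have "e l \<in> {0..\<lfloor>1 / \<mu> l\<rfloor>}" using e l by (auto simp: A_def PiE_iff split: if_splits)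
        then show ?thesis using False by (auto simp: le_floor_iff)
      qed (use \<mu>[OF l] in auto)
      moreover have "of_int (k e l) - t * of_int (c l) =
        of_int (if l = i then 0 else e l) - frac (t * of_int (c l))"
        by (simp add: k_def t_def frac_def)
      moreover have "0 \<le> frac (t * of_int (c l))" "frac (t * of_int (c l)) < 1"
        by (auto simp: frac_lt_1)
      \<comment> \<open>This is where minima of at most 1 are used: the rounding error is absorbed
        into \<open>1 / \<mu> l\<close>.\<close>
      moreover have "1 \<le> 1 / \<mu> l" using \<mu>[OF l] by simp
      ultimately have "\<bar>of_int (k e l) - t * of_int (c l)\<bar> \<le> 2 / \<mu> l" by linarith
      then show ?thesis using \<mu>[OF l] by (simp add: field_simps)
    qed
    have "p (\<psi> e) \<le> p (t *\<^sub>R z) + (\<Sum>l<m. p ((of_int (k e l) - t * of_int (c l)) *\<^sub>R b l))"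
      unfolding \<psi> by (rule order_trans[OF p_add add_left_mono[OF p_sum]])
    also have "\<dots> \<le> 1 + (\<Sum>l<m. 2 * real m)"
    proof (intro add_mono sum_mono)
      show "p (t *\<^sub>R z) \<le> 1" using t z(2) p_nonneg[of z] by (simp add: p_scale mult_le_one)
      fix l assume "l \<in> {..<m}"
      then have l: "l < m" by simp
      have "p ((of_int (k e l) - t * of_int (c l)) *\<^sub>R b l)
         \<le> \<bar>of_int (k e l) - t * of_int (c l)\<bar> * (real m * \<mu> l)"
        unfolding p_scale using pb[OF l] by (intro mult_left_mono) auto
      also have "\<dots> = (\<bar>of_int (k e l) - t * of_int (c l)\<bar> * \<mu> l) * real m" by simp
      also have "\<dots> \<le> 2 * real m" using \<delta>[OF l] by (intro mult_right_mono) auto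
      finally show "p ((of_int (k e l) - t * of_int (c l)) *\<^sub>R b l) \<le> 2 * real m" .
    qed
    also have "\<dots> = \<rho>" by (simp add: \<rho>_def)
    finally have "p (\<psi> e) \<le> \<rho>" .
    moreover have "\<psi> e \<in> G" unfolding \<psi>_def using bG by (intro sum_mem int_scale_mem) auto
    moreover have "\<psi> e \<in> span (x ` {..<m})" unfolding \<psi>_def using bG by (intro comb_in_span) auto
    ultimately show ?thesis by blast
  qed
  have \<mu>prod: "0 < (\<Prod>l<m. \<mu> l)" using \<mu> by (intro prod_pos) auto
  \<comment> \<open>The constructed points number at least this product. Against the upper bound, of
    order 1 over the product of all \<open>\<mu> l\<close>, everything cancels except
    \<open>\<mu> i\<close>.\<close>
  have "real_of_int T * (\<Prod>l\<in>{..<m} - {i}. 1 / \<mu> l) \<le> (\<Prod>l<m. real (card (A l)))"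
  proof -
    have "(\<Prod>l<m. real (card (A l))) = real (card (A i)) * (\<Prod>l\<in>{..<m} - {i}. real (card (A l)))"
      using i by (intro prod.remove) auto
    moreover have "real_of_int T * (\<Prod>l\<in>{..<m} - {i}. 1 / \<mu> l)
       \<le> real (card (A i)) * (\<Prod>l\<in>{..<m} - {i}. real (card (A l)))"
    proof (intro mult_mono prod_mono conjI prod_nonneg)
      show "real_of_int T \<le> real (card (A i))" using T by (simp add: A_def)
      fix l assume l: "l \<in> {..<m} - {i}"
      show "0 \<le> 1 / \<mu> l" using \<mu>[of l] l by simp
      have "0 \<le> \<lfloor>1 / \<mu> l\<rfloor>" using \<mu>[of l] l by simp
      then show "1 / \<mu> l \<le> real (card (A l))" using l by (simp add: A_def)
    qed (use \<mu> in \<open>auto simp: less_imp_le\<close>)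
    ultimately show ?thesis by simp
  qed
  also have "\<dots> = real (card (PiE {..<m} A))" by (simp add: card_PiE)
  also have "\<dots> \<le> real (card {g \<in> G. g \<in> span (x ` {..<m}) \<and> p g \<le> \<rho>})"
  proof (intro of_nat_mono card_inj_on_le[OF inj])
    show "finite {g \<in> G. g \<in> span (x ` {..<m}) \<and> p g \<le> \<rho>}"
      using finite_ball[of \<rho>] by (rule rev_finite_subset) auto
  qed (use into in blast)
  also have "\<dots> \<le> 3 ^ (m * m) * \<rho> ^ m / (\<Prod>l<m. \<mu> l)"
  proof -
    have \<rho>1: "1 \<le> \<rho>" by (simp add: \<rho>_def)
    then show ?thesis unfolding \<mu>_def
      using card_ball_span_le[OF x, of m \<rho>] order_trans[OF small \<rho>1] by simp
  qed
  finally have "real_of_int T * (\<Prod>l\<in>{..<m} - {i}. 1 / \<mu> l) * (\<Prod>l<m. \<mu> l) \<le> 3 ^ (m * m) * \<rho> ^ m"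
    using \<mu>prod by (simp add: field_simps)
  moreover have "(\<Prod>l\<in>{..<m} - {i}. 1 / \<mu> l) * (\<Prod>l<m. \<mu> l) = \<mu> i"
  proof -
    have "(\<Prod>l<m. \<mu> l) = \<mu> i * (\<Prod>l\<in>{..<m} - {i}. \<mu> l)" using i by (intro prod.remove) auto
    moreover have "(\<Prod>l\<in>{..<m} - {i}. \<mu> l) \<noteq> 0" using \<mu> by (fastforce simp: prod_zero_iff)
    ultimately show ?thesis by (simp add: prod_dividef)
  qed
  ultimately show ?thesis by (simp add: T_def \<rho>_def \<mu>_def mult.assoc)
qed

end

section \<open>Dual boxes and orthogonal lattices\<close>

text \<open>Integer vectors of length \<open>q\<close> inside the ambient space: \<open>z\<close>
  has the entries \<open>z \<bullet> u l\<close>, an element \<open>x\<close> of the integer span of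
  the \<open>u l\<close> has the entries \<open>x \<bullet> w l\<close>, and
  \<open>z \<bullet> x\<close> is the inner product of the two entry vectors. Sorted weights are
  what makes \<open>minima_ge_N\<close> work.\<close>

locale dual_box =
  fixes q :: nat and u w :: "nat \<Rightarrow> 'a::euclidean_space" and N :: "nat \<Rightarrow> real"
  assumes dual: "\<And>i l. i < q \<Longrightarrow> l < q \<Longrightarrow> u i \<bullet> w l = (if i = l then 1 else 0)"
    and N_ge1: "\<And>l. l < q \<Longrightarrow> 1 \<le> N l"
    and N_mono: "\<And>i l. i \<le> l \<Longrightarrow> l < q \<Longrightarrow> N i \<le> N l"
begin

definition D :: "'a set" where
  "D = range (\<lambda>c::nat \<Rightarrow> int. \<Sum>l<q. of_int (c l) *\<^sub>R u l)"

text \<open>A weighted l1 norm, dual to the box of the points \<open>z\<close>: if all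
  \<open>\<bar>z \<bullet> u l\<bar> \<le> C * N l\<close>, then
  \<open>\<bar>z \<bullet> x\<bar> \<le> C * p x\<close> for \<open>x \<in> D\<close>.\<close>

definition p :: "'a \<Rightarrow> real" where
  "p x = (\<Sum>l<q. N l * \<bar>x \<bullet> w l\<bar>)"

definition V :: real where
  "V = (\<Prod>l<q. N l)"

definition G :: "'a \<Rightarrow> 'a set" where
  "G z = {x \<in> D. z \<bullet> x = 0}"

lemma N_pos: "l < q \<Longrightarrow> 0 < N l"
  using N_ge1[of l] by simp

lemma V_ge1: "1 \<le> V"
  unfolding V_def using N_ge1 by (intro prod_ge_1) auto

lemma coordinate: "i < q \<Longrightarrow> (\<Sum>l<q. c l *\<^sub>R u l) \<bullet> w i = c i"
  by (rule inner_comb_dual) (simp_all add: dual)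

lemma D_expand:
  assumes "x \<in> D"
  obtains c :: "nat \<Rightarrow> int" where "x = (\<Sum>l<q. of_int (c l) *\<^sub>R u l)"
    "\<And>l. l < q \<Longrightarrow> x \<bullet> w l = of_int (c l)"
proof -
  obtain c :: "nat \<Rightarrow> int" where "x = (\<Sum>l<q. of_int (c l) *\<^sub>R u l)"
    using assms unfolding D_def by (elim rangeE)
  then show thesis using that[of c] coordinate[of _ "\<lambda>l. of_int (c l)"] by simp
qed

lemma p_coordinate: "i < q \<Longrightarrow> N i * \<bar>x \<bullet> w i\<bar> \<le> p x"
  unfolding p_def
  by (rule member_le_sum) (simp_all add: N_pos less_imp_le)

lemma ball_bound:
  assumes "0 \<le> \<rho>"
  shows "finite {x \<in> D. p x \<le> \<rho>} \<and> real (card {x \<in> D. p x \<le> \<rho>}) \<le> (\<Prod>l<q. 2 * \<rho> / N l + 1)"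
proof -
  define A where "A l = {- \<lfloor>\<rho> / N l\<rfloor>..\<lfloor>\<rho> / N l\<rfloor>}" for l
  define \<psi> where "\<psi> c = (\<Sum>l<q. of_int (c l) *\<^sub>R u l)" for c :: "nat \<Rightarrow> int"
  have sub: "{x \<in> D. p x \<le> \<rho>} \<subseteq> \<psi> ` PiE {..<q} A"
  proof clarify
    fix x assume x: "x \<in> D" "p x \<le> \<rho>"
    obtain c :: "nat \<Rightarrow> int" where c: "x = (\<Sum>l<q. of_int (c l) *\<^sub>R u l)"
      "\<And>l. l < q \<Longrightarrow> x \<bullet> w l = of_int (c l)" using D_expand[OF x(1)] by blast
    have "c l \<in> A l" if "l < q" for l
    proof -
      have "N l * \<bar>of_int (c l)\<bar> \<le> \<rho>" using p_coordinate[OF that, of x] c(2)[OF that] x(2) by simp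
      then have "real_of_int \<bar>c l\<bar> \<le> \<rho> / N l" using N_pos[OF that] by (simp add: field_simps)
      then have "\<bar>c l\<bar> \<le> \<lfloor>\<rho> / N l\<rfloor>" by (simp add: le_floor_iff)
      then show ?thesis by (auto simp: A_def)
    qed
    then have "restrict c {..<q} \<in> PiE {..<q} A" by auto
    moreover have "x = \<psi> (restrict c {..<q})" unfolding c(1) \<psi>_def by (intro sum.cong) auto
    ultimately show "x \<in> \<psi> ` PiE {..<q} A" by blast
  qed
  have fin: "finite (PiE {..<q} A)" by (intro finite_PiE) (auto simp: A_def)
  have "card {x \<in> D. p x \<le> \<rho>} \<le> card (PiE {..<q} A)"
    using card_mono[OF finite_imageI[OF fin] sub] card_image_le[OF fin, of \<psi>] by linarith
  then have "real (card {x \<in> D. p x \<le> \<rho>}) \<le> real (card (PiE {..<q} A))" by simp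
  also have "\<dots> = (\<Prod>l<q. real (card (A l)))" by (simp add: card_PiE)
  also have "\<dots> \<le> (\<Prod>l<q. 2 * \<rho> / N l + 1)"
  proof (intro prod_mono conjI)
    fix l assume "l \<in> {..<q}"
    then have "0 \<le> \<rho> / N l" using assms N_pos[of l] by simp
    then have "real (card (A l)) = 2 * of_int \<lfloor>\<rho> / N l\<rfloor> + 1" by (simp add: A_def)
    also have "\<dots> \<le> 2 * \<rho> / N l + 1" using of_int_floor_le[of "\<rho> / N l"] by linarith
    finally show "real (card (A l)) \<le> 2 * \<rho> / N l + 1" .
  qed simp
  finally show ?thesis using finite_subset[OF sub finite_imageI[OF fin]] by simp
qed

section \<open>Counts and minima of orthogonal integer vectors\<close>

lemma D_normed_subgroup: "normed_subgroup D p"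
proof
  show "0 \<in> D" unfolding D_def by (rule range_eqI[of _ _ "\<lambda>_. 0"]) simp
  show "x - y \<in> D" if "x \<in> D" "y \<in> D" for x y using int_comb_diff that unfolding D_def .
  show "p (x + y) \<le> p x + p y" for x y
    unfolding p_def sum.distrib[symmetric] distrib_left[symmetric] inner_add_left
    using N_pos by (intro sum_mono mult_left_mono abs_triangle_ineq) (auto simp: less_imp_le)
  show "p (a *\<^sub>R x) = \<bar>a\<bar> * p x" for a x
    by (simp add: p_def sum_distrib_left abs_mult ac_simps)
  show "finite {x \<in> D. p x \<le> \<rho>}" for \<rho>
    using ball_bound[of "max \<rho> 0"] by (auto elim: rev_finite_subset)
qed

lemma G_normed_subgroup: "normed_subgroup (G z) p"
proof -
  interpret normed_subgroup D p by (rule D_normed_subgroup)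
  show ?thesis
  proof
    show "finite {x \<in> G z. p x \<le> \<rho>}" for \<rho>
      using finite_ball[of \<rho>] by (rule rev_finite_subset) (auto simp: G_def)
  qed (auto simp: G_def zero_mem diff_mem inner_diff_right p_add p_scale)
qed

text \<open>Pigeonhole: the box \<open>X\<close> has at least
  \<open>\<rho> ^ q / (q ^ q * V)\<close> vectors, their inner products with \<open>z\<close> take
  at most \<open>3 * C * \<rho>\<close> integer values, and subtracting a fixed member of a fibre
  sends that fibre injectively into the ball of \<open>G z\<close>. Box sides are divided by
  \<open>q\<close> because \<open>p\<close> is a sum of \<open>q\<close> terms.\<close>

lemma card_G_ball_ge:
  assumes z: "\<And>l. l < q \<Longrightarrow> z \<bullet> u l \<in> \<int>" "\<And>l. l < q \<Longrightarrow> \<bar>z \<bullet> u l\<bar> \<le> C * N l"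
    and "1 \<le> C" "1 \<le> \<rho>" "1 \<le> q"
  shows "\<rho> ^ (q - 1) \<le> 3 * C * real q ^ q * V * real (card {x \<in> G z. p x \<le> \<rho>})"
proof -
  interpret normed_subgroup "G z" p by (rule G_normed_subgroup)
  define A where "A l = {0..\<lfloor>\<rho> / (real q * N l)\<rfloor>}" for l
  define \<psi> where "\<psi> c = (\<Sum>l<q. of_int (c l) *\<^sub>R u l)" for c :: "nat \<Rightarrow> int"
  define X where "X = PiE {..<q} A"
  define P where "P = {- \<lfloor>C * \<rho>\<rfloor>..\<lfloor>C * \<rho>\<rfloor>}"
  define \<phi> where "\<phi> c = \<lfloor>z \<bullet> \<psi> c\<rfloor>" for c
  have qN: "0 < real q * N l" if "l < q" for l using N_pos[OF that] that by simp
  have cA: "0 \<le> c l" "of_int (c l) \<le> \<rho> / (real q * N l)" if "c \<in> X" "l < q" for c l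
    using that by (auto simp: X_def A_def PiE_iff le_floor_iff)
  have z\<psi>: "z \<bullet> \<psi> c = (\<Sum>l<q. of_int (c l) * (z \<bullet> u l))" for c
    by (simp add: \<psi>_def inner_sum_right)
  have \<phi>: "of_int (\<phi> c) = z \<bullet> \<psi> c" for c
  proof -
    have "z \<bullet> \<psi> c \<in> \<int>" unfolding z\<psi> using z(1) by (intro Ints_sum Ints_mult) auto
    then show ?thesis by (simp add: \<phi>_def)
  qed
  have "\<phi> c \<in> P" if c: "c \<in> X" for c
  proof -
    have "\<bar>z \<bullet> \<psi> c\<bar> \<le> (\<Sum>l<q. \<bar>of_int (c l) * (z \<bullet> u l)\<bar>)"
      unfolding z\<psi> by (rule sum_abs)
    also have "\<dots> \<le> (\<Sum>l<q. C * \<rho> / real q)"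
    proof (rule sum_mono)
      fix l assume "l \<in> {..<q}"
      then have l: "l < q" by simp
      have "\<bar>of_int (c l) * (z \<bullet> u l)\<bar> = of_int (c l) * \<bar>z \<bullet> u l\<bar>"
        using cA[OF c l] by (simp add: abs_mult)
      also have "\<dots> \<le> \<rho> / (real q * N l) * (C * N l)"
        using cA[OF c l] z(2)[OF l] \<open>1 \<le> \<rho>\<close> qN[OF l] by (intro mult_mono) auto
      also have "\<dots> = C * \<rho> / real q" using N_pos[OF l] by (simp add: field_simps)
      finally show "\<bar>of_int (c l) * (z \<bullet> u l)\<bar> \<le> C * \<rho> / real q" .
    qed
    also have "\<dots> = C * \<rho>" using \<open>1 \<le> q\<close> by simp
    finally have "\<bar>real_of_int (\<phi> c)\<bar> \<le> C * \<rho>" by (simp add: \<phi>)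
    then have "\<bar>\<phi> c\<bar> \<le> \<lfloor>C * \<rho>\<rfloor>" by (simp add: le_floor_iff)
    then show ?thesis by (auto simp: P_def)
  qed
  then have sub: "\<phi> ` X \<subseteq> P" by blast
  have "card X \<le> card P * card {x \<in> G z. p x \<le> \<rho>}"
  proof (rule card_le_fibers[OF _ sub])
    show "finite P" by (simp add: P_def)
    fix v assume "v \<in> P"
    show "card {c \<in> X. \<phi> c = v} \<le> card {x \<in> G z. p x \<le> \<rho>}"
    proof (cases "{c \<in> X. \<phi> c = v} = {}")
      case True
      then show ?thesis by (metis card.empty le0)
    next
      case False
      then obtain y where y: "y \<in> X" "\<phi> y = v" by blast
      have coord: "(\<psi> c - \<psi> y) \<bullet> w l = of_int (c l) - of_int (y l)" if "l < q" for c l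
        using that by (simp add: \<psi>_def inner_diff_left coordinate)
      have "inj_on (\<lambda>c. \<psi> c - \<psi> y) {c \<in> X. \<phi> c = v}"
      proof (rule inj_onI)
        fix c c' assume c: "c \<in> {c \<in> X. \<phi> c = v}" "c' \<in> {c \<in> X. \<phi> c = v}"
          and eq: "\<psi> c - \<psi> y = \<psi> c' - \<psi> y"
        have "c l = c' l" if "l < q" for l using coord[OF that, of c] coord[OF that, of c'] eq by simp
        then show "c = c'" using c unfolding X_def by (intro PiE_ext[of c "{..<q}" A c']) auto
      qed
      moreover have "(\<lambda>c. \<psi> c - \<psi> y) ` {c \<in> X. \<phi> c = v} \<subseteq> {x \<in> G z. p x \<le> \<rho>}"
      proof (rule image_subsetI)
        fix c assume "c \<in> {c \<in> X. \<phi> c = v}"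
        then have c: "c \<in> X" "\<phi> c = v" by auto
        have "\<psi> c - \<psi> y \<in> D" unfolding D_def \<psi>_def by (intro int_comb_diff) auto
        moreover have "z \<bullet> (\<psi> c - \<psi> y) = 0"
          using \<phi>[of c] \<phi>[of y] c(2) y(2) by (simp add: inner_diff_right)
        moreover have "p (\<psi> c - \<psi> y) \<le> (\<Sum>l<q. \<rho> / real q)"
          unfolding p_def
        proof (rule sum_mono)
          fix l assume "l \<in> {..<q}"
          then have l: "l < q" by simp
          have "\<bar>real_of_int (c l) - of_int (y l)\<bar> \<le> \<rho> / (real q * N l)"
            using cA[OF c(1) l] cA[OF y(1) l] by simp
          then have "N l * \<bar>real_of_int (c l) - of_int (y l)\<bar> \<le> N l * (\<rho> / (real q * N l))"
            using N_pos[OF l] by (intro mult_left_mono) auto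
          then show "N l * \<bar>(\<psi> c - \<psi> y) \<bullet> w l\<bar> \<le> \<rho> / real q"
            using N_pos[OF l] by (simp add: coord[OF l])
        qed
        ultimately show "\<psi> c - \<psi> y \<in> {x \<in> G z. p x \<le> \<rho>}" using \<open>1 \<le> q\<close> by (simp add: G_def)
      qed
      ultimately show ?thesis using finite_ball by (intro card_inj_on_le)
    qed
  qed
  then have "real (card X) \<le> real (card P) * real (card {x \<in> G z. p x \<le> \<rho>})"
    by (metis of_nat_le_iff of_nat_mult)
  also have "\<dots> \<le> (3 * C * \<rho>) * real (card {x \<in> G z. p x \<le> \<rho>})"
  proof (intro mult_right_mono)
    have "1 * 1 \<le> C * \<rho>" using assms by (intro mult_mono) auto
    then have 1: "1 \<le> C * \<rho>" by simp
    then have "0 \<le> \<lfloor>C * \<rho>\<rfloor>" by simp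
    then have "real (card P) = 2 * of_int \<lfloor>C * \<rho>\<rfloor> + 1" by (simp add: P_def)
    also have "\<dots> \<le> 2 * (C * \<rho>) + 1" by simp
    also have "\<dots> \<le> 3 * C * \<rho>" using 1 by simp
    finally show "real (card P) \<le> 3 * C * \<rho>" .
  qed simp
  finally have up: "real (card X) \<le> 3 * C * \<rho> * real (card {x \<in> G z. p x \<le> \<rho>})" by simp
  have "(\<Prod>l<q. \<rho> / (real q * N l)) \<le> (\<Prod>l<q. real (card (A l)))"
  proof (intro prod_mono conjI)
    fix l assume "l \<in> {..<q}"
    then have l: "l < q" by simp
    show "0 \<le> \<rho> / (real q * N l)" using qN[OF l] \<open>1 \<le> \<rho>\<close> by simp
    then have "0 \<le> \<lfloor>\<rho> / (real q * N l)\<rfloor>" by simp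
    then show "\<rho> / (real q * N l) \<le> real (card (A l))" by (simp add: A_def)
  qed
  also have "\<dots> = real (card X)" by (simp add: X_def card_PiE)
  finally have "(\<Prod>l<q. \<rho> / (real q * N l)) \<le> 3 * C * \<rho> * real (card {x \<in> G z. p x \<le> \<rho>})"
    using up by simp
  moreover have "(\<Prod>l<q. \<rho> / (real q * N l)) = \<rho> ^ q / (real q ^ q * V)"
    by (simp add: V_def prod_dividef prod.distrib)
  ultimately have "\<rho> ^ q \<le> 3 * C * \<rho> * real (card {x \<in> G z. p x \<le> \<rho>}) * (real q ^ q * V)"
    using V_ge1 \<open>1 \<le> q\<close> by (simp add: pos_divide_le_eq)
  moreover have "\<rho> ^ q = \<rho> * \<rho> ^ (q - 1)" using \<open>1 \<le> q\<close> by (cases q) auto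
  ultimately have "\<rho> * \<rho> ^ (q - 1) \<le> \<rho> * (3 * C * real q ^ q * V * real (card {x \<in> G z. p x \<le> \<rho>}))"
    by (simp add: ac_simps)
  then show ?thesis using \<open>1 \<le> \<rho>\<close> by simp
qed

text \<open>Growth decides the rank: if \<open>i < q - 1\<close> vectors spanned \<open>G z\<close>,
  its balls would contain only O(\<open>\<rho> ^ i\<close>) points, against a lower bound of order
  \<open>\<rho> ^ (q - 1)\<close>.\<close>

lemma G_minima_exists:
  assumes z: "\<And>l. l < q \<Longrightarrow> z \<bullet> u l \<in> \<int>" "\<And>l. l < q \<Longrightarrow> \<bar>z \<bullet> u l\<bar> \<le> C * N l"
    and C: "1 \<le> C" and r: "r < q"
  shows "\<exists>x. normed_subgroup.minima (G z) p r x"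
proof -
  interpret normed_subgroup "G z" p by (rule G_normed_subgroup)
  show ?thesis
  proof (rule minima_exists)
    fix i x assume i: "i < r" and x: "minima i x"
    show "\<not> G z \<subseteq> span (x ` {..<i})"
    proof
      assume sub: "G z \<subseteq> span (x ` {..<i})"
      define E where "E = 3 * C * real q ^ q * V * (3 ^ (i * i) / (\<Prod>l<i. p (x l)))"
      have Ppos: "0 < (\<Prod>l<i. p (x l))" using minima_pos[OF x] by (intro prod_pos) auto
      have E0: "0 \<le> E" unfolding E_def using C V_ge1 Ppos by simp
      \<comment> \<open>Exceeding \<open>E\<close> yields the contradiction; exceeding every
        \<open>p (x l)\<close> is what \<open>card_ball_span_le\<close> asks for.\<close>
      define \<rho> where "\<rho> = 1 + E + (\<Sum>l<i. p (x l))"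
      have s0: "0 \<le> (\<Sum>l<i. p (x l))" using p_nonneg by (simp add: sum_nonneg)
      have \<rho>: "1 \<le> \<rho>" "E < \<rho>" using E0 s0 by (auto simp: \<rho>_def)
      have px: "p (x l) \<le> \<rho>" if "l < i" for l
      proof -
        have "p (x l) \<le> (\<Sum>l<i. p (x l))" using that p_nonneg by (intro member_le_sum) auto
        then show ?thesis using E0 by (simp add: \<rho>_def)
      qed
      have "{g \<in> G z. p g \<le> \<rho>} = {g \<in> G z. g \<in> span (x ` {..<i}) \<and> p g \<le> \<rho>}" using sub by auto
      then have card: "real (card {g \<in> G z. p g \<le> \<rho>}) \<le> 3 ^ (i * i) * \<rho> ^ i / (\<Prod>l<i. p (x l))"
        using card_ball_span_le[OF x, of i \<rho>] px \<rho> by simp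
      have "\<rho> ^ (q - 1) \<le> 3 * C * real q ^ q * V * real (card {g \<in> G z. p g \<le> \<rho>})"
        using card_G_ball_ge[OF z C \<rho>(1)] r by simp
      also have "\<dots> \<le> 3 * C * real q ^ q * V * (3 ^ (i * i) * \<rho> ^ i / (\<Prod>l<i. p (x l)))"
        using card C V_ge1 by (intro mult_left_mono) auto
      also have "\<dots> = E * \<rho> ^ i" by (simp add: E_def)
      finally have "\<rho> ^ (q - 1) \<le> E * \<rho> ^ i" .
      also have "\<dots> < \<rho> * \<rho> ^ i" using \<rho> by (intro mult_strict_right_mono) auto
      also have "\<dots> = \<rho> ^ Suc i" by simp
      also have "\<dots> \<le> \<rho> ^ (q - 1)" using \<rho> i r by (intro power_increasing) auto
      finally show False by simp
    qed
  qed
qed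

text \<open>\<open>2 ^ q\<close> pays for halving a radius, the bracket is the pigeonhole constant
  of \<open>card_G_ball_ge\<close>, and the last factor comes from
  \<open>card_ball_span_le\<close>.\<close>

definition minima_const :: "real \<Rightarrow> real" where
  "minima_const C = 2 ^ q * (3 * C * real q ^ q) * 3 ^ (q * q)"

lemma D_p_ge1:
  assumes "x \<in> D" "x \<noteq> 0"
  shows "1 \<le> p x"
proof -
  obtain c :: "nat \<Rightarrow> int" where c: "x = (\<Sum>l<q. of_int (c l) *\<^sub>R u l)"
      "\<And>l. l < q \<Longrightarrow> x \<bullet> w l = of_int (c l)" using D_expand[OF assms(1)] by blast
  obtain l where l: "l < q" "c l \<noteq> 0"
  proof (rule ccontr)
    assume "\<not> thesis"
    then have "x = (\<Sum>l<q. 0)" unfolding c(1) using that by (intro sum.cong) auto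
    then show False using assms(2) by simp
  qed
  have "1 * 1 \<le> N l * \<bar>of_int (c l)\<bar>" using l N_ge1[OF l(1)] by (intro mult_mono) auto
  then show ?thesis using p_coordinate[OF l(1), of x] c(2)[OF l(1)] by simp
qed

text \<open>The ball of radius \<open>p (x s) / 2\<close> lies in the span of the \<open>s\<close>
  earlier vectors, so \<open>card_ball_span_le\<close> bounds from above the count that
  \<open>card_G_ball_ge\<close> bounds from below. The latter needs radius at least 1; if
  \<open>p (x s) < 2\<close>, all the factors are at most 2 and \<open>1 \<le> V\<close> is
  enough.\<close>

lemma G_minima_prod_le:
  assumes z: "\<And>l. l < q \<Longrightarrow> z \<bullet> u l \<in> \<int>" "\<And>l. l < q \<Longrightarrow> \<bar>z \<bullet> u l\<bar> \<le> C * N l"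
    and C: "1 \<le> C" and s: "Suc s < q" and x: "normed_subgroup.minima (G z) p (Suc s) x"
  shows "(\<Prod>l<s. p (x l)) * p (x s) ^ (q - Suc s) \<le> minima_const C * V"
proof -
  interpret normed_subgroup "G z" p by (rule G_normed_subgroup)
  define \<mu> where "\<mu> = p (x s)"
  have \<mu>0: "0 < \<mu>" using minima_pos[OF x] by (simp add: \<mu>_def)
  have le: "p (x l) \<le> \<mu>" if "l < s" for l using minima_mono[OF x] that by (simp add: \<mu>_def)
  have xs: "minima s x" using minima_antimono[OF x] by simp
  have Ppos: "0 < (\<Prod>l<s. p (x l))" using minima_pos[OF xs] by (intro prod_pos) auto
  have K1: "1 \<le> 3 * C * real q ^ q"
  proof -
    have "1 * 1 \<le> (3 * C) * real q ^ q" using C s by (intro mult_mono one_le_power) auto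
    then show ?thesis by simp
  qed
  show ?thesis
  proof (cases "2 \<le> \<mu>")
    case True
    have "{g \<in> G z. p g \<le> \<mu> / 2} \<subseteq> {g \<in> G z. g \<in> span (x ` {..<s}) \<and> p g \<le> \<mu>}"
    proof clarify
      fix g assume g: "g \<in> G z" "p g \<le> \<mu> / 2"
      then have "p g < p (x s)" using \<mu>0 by (simp add: \<mu>_def)
      then show "g \<in> span (x ` {..<s}) \<and> p g \<le> \<mu>"
        using minima_le[OF x _ g(1)] g(2) \<mu>0 by fastforce
    qed
    then have "real (card {g \<in> G z. p g \<le> \<mu> / 2})
        \<le> real (card {g \<in> G z. g \<in> span (x ` {..<s}) \<and> p g \<le> \<mu>})"
      using finite_ball[of \<mu>] by (intro of_nat_mono card_mono) (auto elim: rev_finite_subset)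
    also have "\<dots> \<le> 3 ^ (s * s) * \<mu> ^ s / (\<Prod>l<s. p (x l))"
      using card_ball_span_le[OF xs, of s \<mu>] le \<mu>0 by simp
    finally have card: "real (card {g \<in> G z. p g \<le> \<mu> / 2}) \<le> 3 ^ (s * s) * \<mu> ^ s / (\<Prod>l<s. p (x l))" .
    have "(\<mu> / 2) ^ (q - 1) \<le> 3 * C * real q ^ q * V * real (card {g \<in> G z. p g \<le> \<mu> / 2})"
      using card_G_ball_ge[OF z C, of "\<mu> / 2"] True s by simp
    also have "\<dots> \<le> 3 * C * real q ^ q * V * (3 ^ (s * s) * \<mu> ^ s / (\<Prod>l<s. p (x l)))"
      using card C V_ge1 by (intro mult_left_mono) auto
    finally have "(\<mu> / 2) ^ (q - 1) * (\<Prod>l<s. p (x l)) \<le> 3 * C * real q ^ q * V * 3 ^ (s * s) * \<mu> ^ s"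
      using Ppos by (simp add: field_simps)
    then have "\<mu> ^ (q - 1) * (\<Prod>l<s. p (x l)) \<le> 2 ^ (q - 1) * (3 * C * real q ^ q * V * 3 ^ (s * s) * \<mu> ^ s)"
      by (simp add: power_divide field_simps)
    moreover have "\<mu> ^ (q - 1) = \<mu> ^ (q - Suc s) * \<mu> ^ s"
      using s by (simp add: power_add[symmetric])
    ultimately have "((\<Prod>l<s. p (x l)) * \<mu> ^ (q - Suc s)) * \<mu> ^ s
        \<le> (2 ^ (q - 1) * (3 * C * real q ^ q) * 3 ^ (s * s) * V) * \<mu> ^ s"
      by (simp add: ac_simps)
    then have "(\<Prod>l<s. p (x l)) * \<mu> ^ (q - Suc s) \<le> 2 ^ (q - 1) * (3 * C * real q ^ q) * 3 ^ (s * s) * V"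
      using \<mu>0 by simp
    also have "\<dots> \<le> minima_const C * V"
      unfolding minima_const_def using K1 V_ge1 s
      by (intro mult_right_mono mult_mono power_increasing mult_le_mono) auto
    finally show ?thesis by (simp add: \<mu>_def)
  next
    case False
    have "p (x l) \<le> 2" if "l < s" for l using le[OF that] False by simp
    then have "(\<Prod>l<s. p (x l)) \<le> (\<Prod>l<s. 2)" using p_nonneg by (intro prod_mono) auto
    then have "(\<Prod>l<s. p (x l)) * \<mu> ^ (q - Suc s) \<le> (\<Prod>l<s. 2) * 2 ^ (q - Suc s)"
      using False \<mu>0 by (intro mult_mono power_mono) auto
    also have "\<dots> = 2 ^ (q - 1)" using s by (simp add: power_add[symmetric])
    also have "\<dots> \<le> 2 ^ q * 1 * 1 * 1" by simp
    also have "\<dots> \<le> minima_const C * V"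
      unfolding minima_const_def using K1 V_ge1 by (intro mult_mono) auto
    finally show ?thesis by (simp add: \<mu>_def)
  qed
qed

text \<open>If \<open>N l\<close> exceeded \<open>M\<close>, a nonzero integer entry at any index
  from \<open>l\<close> on would cost more than \<open>M\<close>. Then \<open>l + 1\<close>
  independent vectors would lie in the span of the first \<open>l\<close> vectors
  \<open>u\<close>.\<close>

lemma minima_ge_N:
  assumes x: "\<And>a. a \<le> l \<Longrightarrow> x a \<in> D" "\<And>a. a \<le> l \<Longrightarrow> x a \<notin> span (x ` {..<a})"
    and M: "\<And>a. a \<le> l \<Longrightarrow> p (x a) \<le> M" and l: "l < q"
  shows "N l \<le> M"
proof (rule ccontr)
  assume "\<not> N l \<le> M"
  have "x a \<in> span (u ` {..<l})" if a: "a \<le> l" for a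
  proof -
    obtain c :: "nat \<Rightarrow> int" where c: "x a = (\<Sum>i<q. of_int (c i) *\<^sub>R u i)"
      "\<And>i. i < q \<Longrightarrow> x a \<bullet> w i = of_int (c i)" using D_expand[OF x(1)[OF a]] by blast
    have "c i = 0" if i: "l \<le> i" "i < q" for i
    proof (rule ccontr)
      assume "c i \<noteq> 0"
      then have "N i * 1 \<le> N i * \<bar>x a \<bullet> w i\<bar>" using c(2)[OF i(2)] N_pos[OF i(2)] by (intro mult_left_mono) auto
      then have "N l \<le> M" using p_coordinate[OF i(2), of "x a"] M[OF a] N_mono[OF i] by simp
      then show False using \<open>\<not> N l \<le> M\<close> by simp
    qed
    then have "x a = (\<Sum>i<l. of_int (c i) *\<^sub>R u i)"
      unfolding c(1) using l by (intro sum.mono_neutral_right) auto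
    then show ?thesis using comb_in_span[of l u "u ` {..<l}"] by (simp add: span_base)
  qed
  then have "x ` {..<Suc l} \<subseteq> span (u ` {..<l})" by (auto simp: less_Suc_eq_le)
  moreover have "independent (x ` {..<Suc l})" "card (x ` {..<Suc l}) = Suc l"
    using seq_independent[of "Suc l" x] x(2) by (auto simp: card_image less_Suc_eq_le)
  ultimately have "Suc l \<le> card (u ` {..<l})"
    using independent_span_bound[of "u ` {..<l}" "x ` {..<Suc l}"] by auto
  then show False using card_image_le[of "{..<l}" u] by simp
qed

end

section \<open>Counting spans\<close>

context dual_box
begin

text \<open>Subspaces are collected, not sequences: many sequences share a span, and counting them
  separately would overshoot.\<close>

definition spans :: "(nat \<Rightarrow> real) \<Rightarrow> nat \<Rightarrow> 'a set set" where
  "spans M i = {span (x ` {..<i}) | x. \<forall>l<i. x l \<in> D \<and> x l \<notin> span (x ` {..<l}) \<and> p (x l) \<le> M l}"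

definition extensions :: "(nat \<Rightarrow> 'a) \<Rightarrow> nat \<Rightarrow> real \<Rightarrow> 'a set set" where
  "extensions x i R = (\<lambda>y. span (insert y (x ` {..<i}))) `
     {y \<in> D. y \<notin> span (x ` {..<i}) \<and> p y \<le> R}"

lemma finite_extensions: "finite (extensions x i R)"
proof -
  interpret normed_subgroup D p by (rule D_normed_subgroup)
  show ?thesis unfolding extensions_def
    using finite_ball[of R] by (intro finite_imageI) (auto elim: rev_finite_subset)
qed

text \<open>Translates of a box in the old span by one representative per extension are disjoint.\<close>

lemma card_extensions:
  assumes x: "\<And>l. l < i \<Longrightarrow> x l \<in> D" "\<And>l. l < i \<Longrightarrow> x l \<notin> span (x ` {..<l})"
      "\<And>l. l < i \<Longrightarrow> p (x l) \<le> M l"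
    and M: "\<And>l. l < i \<Longrightarrow> 0 < M l" "0 < R" and i: "i < q"
  shows "real (card (extensions x i R)) \<le>
    (3 * real q) ^ q * (\<Prod>l<q. max 1 (R / N l)) * (\<Prod>l<i. M l / R)"
proof -
  interpret normed_subgroup D p by (rule D_normed_subgroup)
  define A where "A l = {0..\<lfloor>R / M l\<rfloor>}" for l
  \<comment> \<open>One \<open>R\<close> is for the representative and one for each of the
    \<open>i < q\<close> old vectors.\<close>
  define B where "B = {g \<in> D. p g \<le> real q * R}"
  have "\<forall>U\<in>extensions x i R. \<exists>y. y \<in> D \<and> p y \<le> R \<and> U = span (insert y (x ` {..<i}))"
    by (auto simp: extensions_def)
  then obtain y where y: "\<And>U. U \<in> extensions x i R \<Longrightarrow> y U \<in> D"
      "\<And>U. U \<in> extensions x i R \<Longrightarrow> p (y U) \<le> R"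
      "\<And>U. U \<in> extensions x i R \<Longrightarrow> U = span (insert (y U) (x ` {..<i}))" by metis
  define s where "s e = (\<Sum>l<i. of_int (e l) *\<^sub>R x l)" for e :: "nat \<Rightarrow> int"
  have sW: "s e \<in> span (x ` {..<i})" for e
    unfolding s_def by (rule comb_in_span) (auto intro: span_base)
  define \<psi> where "\<psi> = (\<lambda>(U, e). y U + s e)"
  let ?E = "PiE {..<i} A"
  have inj: "inj_on \<psi> (extensions x i R \<times> ?E)"
  proof (rule inj_onI, clarify)
    fix U e U' e'
    assume U: "U \<in> extensions x i R" "U' \<in> extensions x i R" and e: "e \<in> ?E" "e' \<in> ?E"
      and "\<psi> (U, e) = \<psi> (U', e')"
    then have eq: "y U + s e = y U' + s e'" by (simp add: \<psi>_def)
    then have "y U - y U' = s e' - s e" by (simp add: algebra_simps)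
    then have "y U - y U' \<in> span (x ` {..<i})" using sW by (simp add: span_diff)
    then have "span (insert (y U) (x ` {..<i})) = span (insert (y U') (x ` {..<i}))"
      by (rule eq_span_insert_eq)
    then have "U = U'" using y(3)[OF U(1)] y(3)[OF U(2)] by simp
    moreover have "e = e'"
    proof -
      have "inj_on s ?E" unfolding s_def
        by (rule comb_inj_on) (simp_all add: x(2) inj_def)
      moreover have "s e = s e'" using eq \<open>U = U'\<close> by simp
      ultimately show ?thesis using e by (auto dest: inj_onD)
    qed
    ultimately show "U = U' \<and> e = e'" by simp
  qed
  have into: "\<psi> (U, e) \<in> B" if U: "U \<in> extensions x i R" and e: "e \<in> ?E" for U e
  proof -
    have "p (s e) \<le> (\<Sum>l<i. p (of_int (e l) *\<^sub>R x l))" unfolding s_def by (rule p_sum)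
    also have "\<dots> \<le> (\<Sum>l<i. R)"
    proof (rule sum_mono)
      fix l assume "l \<in> {..<i}"
      then have l: "l < i" by simp
      then have "e l \<in> A l" using e by auto
      then have el: "0 \<le> e l" "of_int (e l) \<le> R / M l" by (auto simp: A_def le_floor_iff)
      have "p (of_int (e l) *\<^sub>R x l) = of_int (e l) * p (x l)" using el by (simp add: p_scale)
      also have "\<dots> \<le> (R / M l) * M l"
        using el x(3)[OF l] p_nonneg M(1)[OF l] M(2) by (intro mult_mono) auto
      also have "\<dots> = R" using M(1)[OF l] by simp
      finally show "p (of_int (e l) *\<^sub>R x l) \<le> R" .
    qed
    finally have "p (y U + s e) \<le> R + real i * R" using p_add[of "y U" "s e"] y(2)[OF U] by simp
    also have "\<dots> = real (Suc i) * R" by (simp add: algebra_simps)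
    also have "\<dots> \<le> real q * R" using i M(2) by (intro mult_right_mono) auto
    finally have "p (y U + s e) \<le> real q * R" .
    moreover have "s e \<in> D" unfolding s_def using x(1) by (intro sum_mem int_scale_mem) auto
    ultimately show ?thesis using y(1)[OF U] by (simp add: B_def \<psi>_def add_mem)
  qed
  have "card (extensions x i R) * card ?E = card (extensions x i R \<times> ?E)" by (simp add: card_cartesian_product)
  also have "\<dots> \<le> card B"
    using into finite_ball by (intro card_inj_on_le[OF inj]) (auto simp: B_def)
  finally have "real (card (extensions x i R)) * real (card ?E) \<le> real (card B)"
    by (metis of_nat_le_iff of_nat_mult)
  also have "\<dots> \<le> (\<Prod>l<q. 2 * (real q * R) / N l + 1)"
    unfolding B_def using ball_bound[of "real q * R"] M(2) by simp
  also have "\<dots> \<le> (\<Prod>l<q. 3 * real q * max 1 (R / N l))"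
  proof (intro prod_mono conjI)
    fix l assume "l \<in> {..<q}"
    then have l: "l < q" by simp
    show "0 \<le> 2 * (real q * R) / N l + 1" using N_pos[OF l] M(2) by simp
    have q: "1 \<le> real q" using i by simp
    have "2 * (real q * R) / N l = 2 * real q * (R / N l)" by simp
    also have "\<dots> \<le> 2 * real q * max 1 (R / N l)" by (intro mult_left_mono) auto
    finally have "2 * (real q * R) / N l \<le> 2 * real q * max 1 (R / N l)" .
    moreover have "1 * 1 \<le> real q * max 1 (R / N l)" using q by (intro mult_mono) auto
    ultimately show "2 * (real q * R) / N l + 1 \<le> 3 * real q * max 1 (R / N l)" by simp
  qed
  also have "\<dots> = (3 * real q) ^ q * (\<Prod>l<q. max 1 (R / N l))" by (simp add: prod.distrib)
  finally have up: "real (card (extensions x i R)) * real (card ?E)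
     \<le> (3 * real q) ^ q * (\<Prod>l<q. max 1 (R / N l))" .
  have "(\<Prod>l<i. R / M l) \<le> (\<Prod>l<i. real (card (A l)))"
  proof (intro prod_mono conjI)
    fix l assume "l \<in> {..<i}"
    then show "0 \<le> R / M l" using M(1)[of l] M(2) by simp
    then have "0 \<le> \<lfloor>R / M l\<rfloor>" by simp
    then show "R / M l \<le> real (card (A l))" by (simp add: A_def)
  qed
  also have "\<dots> = real (card ?E)" by (simp add: card_PiE)
  finally have "real (card (extensions x i R)) * (\<Prod>l<i. R / M l)
     \<le> real (card (extensions x i R)) * real (card ?E)" by (intro mult_left_mono) auto
  then have "real (card (extensions x i R)) * (\<Prod>l<i. R / M l)
     \<le> (3 * real q) ^ q * (\<Prod>l<q. max 1 (R / N l))" using up by simp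
  then have "real (card (extensions x i R)) * (\<Prod>l<i. R / M l) * (\<Prod>l<i. M l / R)
     \<le> (3 * real q) ^ q * (\<Prod>l<q. max 1 (R / N l)) * (\<Prod>l<i. M l / R)"
    using M by (intro mult_right_mono prod_nonneg) (auto simp: less_imp_le)
  moreover have "(\<Prod>l<i. R / M l) * (\<Prod>l<i. M l / R) = 1"
    unfolding prod.distrib[symmetric] using M by (intro prod.neutral) (auto simp: less_imp_neq[symmetric])
  ultimately show ?thesis by (simp add: mult.assoc)
qed

definition span_bound :: "(nat \<Rightarrow> real) \<Rightarrow> nat \<Rightarrow> real" where
  "span_bound M i = (\<Prod>a<i. (3 * real q) ^ q * (\<Prod>l<q. max 1 (M a / N l)) * (\<Prod>l<a. M l / M a))"

text \<open>The possible extensions depend on the old vectors only through their span, so one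
  representative sequence per span suffices, and the bounds of \<open>card_extensions\<close>
  multiply to \<open>span_bound\<close>.\<close>

lemma card_spans:
  assumes M: "\<And>l. l < i \<Longrightarrow> 0 < M l" and i: "i \<le> q"
  shows "finite (spans M i) \<and> real (card (spans M i)) \<le> span_bound M i"
  using assms
proof (induction i)
  case 0
  have "spans M 0 = {{0}}" by (auto simp: spans_def)
  then show ?case by (simp add: span_bound_def)
next
  case (Suc i)
  define T where "T = (3 * real q) ^ q * (\<Prod>l<q. max 1 (M i / N l)) * (\<Prod>l<i. M l / M i)"
  have IH: "finite (spans M i)" "real (card (spans M i)) \<le> span_bound M i" using Suc by auto
  have "\<forall>W\<in>spans M i. \<exists>x. W = span (x ` {..<i}) \<and>
      (\<forall>l<i. x l \<in> D \<and> x l \<notin> span (x ` {..<l}) \<and> p (x l) \<le> M l)"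
    by (auto simp: spans_def)
  then obtain x where x: "\<And>W. W \<in> spans M i \<Longrightarrow> W = span (x W ` {..<i})"
      "\<And>W l. W \<in> spans M i \<Longrightarrow> l < i \<Longrightarrow> x W l \<in> D \<and> x W l \<notin> span (x W ` {..<l}) \<and> p (x W l) \<le> M l"
    by metis
  have sub: "spans M (Suc i) \<subseteq> (\<Union>W\<in>spans M i. extensions (x W) i (M i))"
  proof
    fix U assume "U \<in> spans M (Suc i)"
    then obtain y where y: "U = span (y ` {..<Suc i})"
        "\<And>l. l < Suc i \<Longrightarrow> y l \<in> D \<and> y l \<notin> span (y ` {..<l}) \<and> p (y l) \<le> M l"
      by (auto simp: spans_def)
    define W where "W = span (y ` {..<i})"
    have W: "W \<in> spans M i" using y(2) by (auto simp: spans_def W_def)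
    have eq: "span (x W ` {..<i}) = span (y ` {..<i})" using x(1)[OF W] by (simp add: W_def)
    have "U = span (insert (y i) (y ` {..<i}))" using y(1) by (simp add: lessThan_Suc)
    also have "\<dots> = span (insert (y i) (x W ` {..<i}))" by (simp add: span_insert eq)
    finally have "U \<in> extensions (x W) i (M i)"
      unfolding extensions_def using y(2)[of i] eq by blast
    then show "U \<in> (\<Union>W\<in>spans M i. extensions (x W) i (M i))" using W by blast
  qed
  have fin: "finite (\<Union>W\<in>spans M i. extensions (x W) i (M i))" using IH(1) finite_extensions by blast
  have "card (spans M (Suc i)) \<le> (\<Sum>W\<in>spans M i. card (extensions (x W) i (M i)))"
    by (rule order_trans[OF card_mono[OF fin sub] card_UN_le[OF IH(1)]])
  then have "real (card (spans M (Suc i))) \<le> (\<Sum>W\<in>spans M i. real (card (extensions (x W) i (M i))))"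
    by (metis of_nat_le_iff of_nat_sum)
  also have "\<dots> \<le> (\<Sum>W\<in>spans M i. T)"
  proof (rule sum_mono)
    fix W assume W: "W \<in> spans M i"
    show "real (card (extensions (x W) i (M i))) \<le> T"
      unfolding T_def using x(2)[OF W] Suc.prems by (intro card_extensions) auto
  qed
  also have "\<dots> = real (card (spans M i)) * T" by simp
  also have "\<dots> \<le> span_bound M i * T"
    using IH(2) Suc.prems unfolding T_def
    by (intro mult_right_mono mult_nonneg_nonneg prod_nonneg) (auto simp: less_imp_le)
  also have "\<dots> = span_bound M (Suc i)" by (simp add: span_bound_def T_def)
  finally show ?case using finite_subset[OF sub fin] by blast
qed

end

section \<open>Summation over dyadic ranges\<close>

lemma abel_sum_nonpos:
  fixes \<gamma> w :: "nat \<Rightarrow> real"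
  assumes "\<And>i j. a \<le> i \<Longrightarrow> i \<le> j \<Longrightarrow> j < r \<Longrightarrow> w i \<le> w j"
    and "\<And>i. a \<le> i \<Longrightarrow> i < r \<Longrightarrow> 0 \<le> w i"
    and "\<And>i. a \<le> i \<Longrightarrow> i < r \<Longrightarrow> (\<Sum>j\<in>{i..<r}. \<gamma> j) \<le> 0"
  shows "(\<Sum>i\<in>{a..<r}. \<gamma> i * w i) \<le> 0"
proof -
  \<comment> \<open>Abel summation from the top. Keeping the factor \<open>w b\<close> strengthens
    the claim enough for induction: nonpositive suffix sums allow \<open>w (Suc b)\<close> to be
    replaced by the smaller \<open>w b\<close>.\<close>
  have abel: "(\<Sum>i\<in>{b..<r}. \<gamma> i * w i) \<le> w b * (\<Sum>i\<in>{b..<r}. \<gamma> i)" if "a \<le> b" "b < r" for b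
    using that(2,1)
  proof (induction "r - b" arbitrary: b)
    case 0
    then show ?case by simp
  next
    case (Suc n)
    show ?case
    proof (cases "Suc b < r")
      case True
      have split: "{b..<r} = insert b {Suc b..<r}" using True by auto
      have "(\<Sum>i\<in>{Suc b..<r}. \<gamma> i * w i) \<le> w (Suc b) * (\<Sum>i\<in>{Suc b..<r}. \<gamma> i)"
        using Suc True by (intro Suc.hyps(1)) auto
      also have "\<dots> \<le> w b * (\<Sum>i\<in>{Suc b..<r}. \<gamma> i)"
        using assms(1)[of b "Suc b"] assms(3)[of "Suc b"] Suc.prems True
        by (intro mult_right_mono_neg) auto
      finally show ?thesis unfolding split by (simp add: algebra_simps)
    next
      case False
      then have "{b..<r} = {b}" using Suc.prems by auto
      then show ?thesis by simp
    qed
  qed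
  show ?thesis
  proof (cases "a < r")
    case True
    have "w a * (\<Sum>i\<in>{a..<r}. \<gamma> i) \<le> 0"
      using assms(2,3)[of a] True by (intro mult_nonneg_nonpos) auto
    then show ?thesis using abel[of a] True by simp
  qed simp
qed

lemma mono_sign_split:
  fixes w :: "nat \<Rightarrow> real"
  assumes "\<And>i j. i \<le> j \<Longrightarrow> j < r \<Longrightarrow> w i \<le> w j"
  obtains t where "t \<le> r" "\<And>i. i < t \<Longrightarrow> w i \<le> 0" "\<And>i. t \<le> i \<Longrightarrow> i < r \<Longrightarrow> 0 < w i"
proof (cases "\<exists>i<r. 0 < w i")
  case True
  define t where "t = (LEAST i. i < r \<and> 0 < w i)"
  have t: "t < r \<and> 0 < w t" unfolding t_def using True by (rule LeastI_ex)
  have "w i \<le> 0" if "i < t" for i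
    using not_less_Least[of i "\<lambda>i. i < r \<and> 0 < w i"] that t by (auto simp: t_def)
  moreover have "0 < w i" if "t \<le> i" "i < r" for i
    using assms[OF that] t by linarith
  ultimately show thesis using that[of t] t by simp
next
  case False
  then have "w i \<le> 0" if "i < r" for i using that by (meson not_less)
  then show thesis using that[of r] by simp
qed

lemma sum_linear_interval:
  assumes "a \<le> s"
  shows "(\<Sum>i\<in>{a..<Suc s}. A - 2 * real i) = (real s + 1 - real a) * (A - real a - real s)"
  using assms
proof (induction s rule: dec_induct)
  case (step n)
  then have "{a..<Suc (Suc n)} = insert (Suc n) {a..<Suc n}" by auto
  then show ?case using step by (simp add: algebra_simps)
qed (simp add: algebra_simps)

text \<open>Subtracting \<open>\<theta>\<close> times the constraint makes every term with \<open>w i \<le> 0\<close> nonpositive and every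
suffix sum of the coefficients of the positive \<open>w i\<close> nonpositive; the slack is \<open>q - r - 1 \<ge> 1\<close>.\<close>

lemma exponent_bound:
  fixes w :: "nat \<Rightarrow> real"
  assumes mono: "\<And>i j. i \<le> j \<Longrightarrow> j < r \<Longrightarrow> w i \<le> w j" and r: "r = Suc s" and q: "r + 2 \<le> q"
    and constr: "(\<Sum>i<s. w i) + (real q - real r) * w s \<le> c" and c: "0 \<le> c"
  shows "(\<Sum>i<r. (real (if w i \<le> 0 then Suc i else q) + real s - 2 * real i) * w i)
     + (\<Sum>i<r. \<bar>w i\<bar>) / (2 * real q) \<le> (real r + 1) * c"
proof -
  define \<epsilon> where "\<epsilon> = 1 / (2 * real q)"
  have \<epsilon>: "0 < \<epsilon>" "\<epsilon> \<le> 1" "\<epsilon> * (2 * real q) = 1" using q by (auto simp: \<epsilon>_def)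
  obtain t where t: "t \<le> r" "\<And>i. i < t \<Longrightarrow> w i \<le> 0" "\<And>i. t \<le> i \<Longrightarrow> i < r \<Longrightarrow> 0 < w i"
    using mono_sign_split[of r w] mono by blast
  \<comment> \<open>For \<open>t < r\<close> this is the largest multiplier of the constraint that
    keeps the coefficient at the last nonpositive index, \<open>t - 1\<close>, nonnegative. If no
    \<open>w i\<close> is positive, the constraint is not invoked.\<close>
  define \<theta> where "\<theta> = (if t = r then 0 else real r + 1 - real t - \<epsilon>)"
  have \<theta>: "0 \<le> \<theta>" "\<theta> \<le> real r + 1" using t(1) \<epsilon> by (auto simp: \<theta>_def)
  define \<delta> where "\<delta> i = (if i = s then real q - real r else 1)" for i
  \<comment> \<open>The first part is the exponent from the box count, \<open>Suc i\<close> below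
    the critical size and \<open>q\<close> above it; \<open>s - 2 i\<close> comes from dividing by
    translates in the old span, through \<open>sum_pairwise_diff\<close>.\<close>
  define \<kappa> where "\<kappa> i = real (if w i \<le> 0 then Suc i else q) + real s - 2 * real i" for i
  define T where "T i = \<kappa> i * w i + \<epsilon> * \<bar>w i\<bar> - \<theta> * (\<delta> i * w i)" for i
  have neg: "T i \<le> 0" if i: "i < t" for i
  proof -
    have wi: "w i \<le> 0" using t(2)[OF i] .
    have "0 \<le> \<kappa> i - \<epsilon> - \<theta> * \<delta> i"
    proof (cases "t = r")
      case True
      then show ?thesis using wi i r \<epsilon> by (simp add: \<theta>_def \<kappa>_def)
    next
      case False
      then have "i \<noteq> s" using i t(1) r by simp
      then show ?thesis using wi i r False by (simp add: \<theta>_def \<kappa>_def \<delta>_def)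
    qed
    then have "(\<kappa> i - \<epsilon> - \<theta> * \<delta> i) * w i \<le> 0" using wi by (rule mult_nonneg_nonpos)
    moreover have "T i = (\<kappa> i - \<epsilon> - \<theta> * \<delta> i) * w i" using wi by (simp add: T_def algebra_simps)
    ultimately show ?thesis by simp
  qed
  have pos: "(\<Sum>i\<in>{t..<r}. T i) \<le> 0"
  proof -
    define \<gamma> where "\<gamma> i = (real q + real s - 2 * real i) + \<epsilon> - \<theta> * \<delta> i" for i
    have "(\<Sum>i\<in>{t..<r}. T i) = (\<Sum>i\<in>{t..<r}. \<gamma> i * w i)"
    proof (rule sum.cong[OF refl])
      fix i assume "i \<in> {t..<r}"
      then have "0 < w i" using t(3) by auto
      then show "T i = \<gamma> i * w i" by (simp add: T_def \<gamma>_def \<kappa>_def algebra_simps)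
    qed
    also have "\<dots> \<le> 0"
    proof (rule abel_sum_nonpos)
      fix a assume a: "t \<le> a" "a < r"
      have as: "a \<le> s" using a r by simp
      have \<delta>sum: "(\<Sum>i\<in>{a..<r}. \<delta> i) = real q - 1 - real a"
      proof -
        have "{a..<r} = insert s {a..<s}" using as r by auto
        moreover have "(\<Sum>i\<in>{a..<s}. \<delta> i) = (\<Sum>i\<in>{a..<s}. 1)" by (intro sum.cong) (auto simp: \<delta>_def)
        ultimately show ?thesis using as r by (simp add: \<delta>_def of_nat_diff)
      qed
      have "(\<Sum>i\<in>{a..<r}. \<gamma> i) = (\<Sum>i\<in>{a..<r}. real q + real s - 2 * real i)
         + (\<Sum>i\<in>{a..<r}. \<epsilon>) - \<theta> * (\<Sum>i\<in>{a..<r}. \<delta> i)"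
        by (simp add: \<gamma>_def sum.distrib sum_subtractf sum_distrib_left)
      also have "\<dots> = (real r - real a) * (real q - real a) + (real r - real a) * \<epsilon>
          - \<theta> * (real q - 1 - real a)"
      proof -
        have "(\<Sum>i\<in>{a..<r}. real q + real s - 2 * real i) = (real r - real a) * (real q - real a)"
          using sum_linear_interval[OF as, of "real q + real s"] unfolding r by (simp add: algebra_simps)
        moreover have "(\<Sum>i\<in>{a..<r}. \<epsilon>) = (real r - real a) * \<epsilon>" using a by (simp add: of_nat_diff)
        ultimately show ?thesis by (simp only: \<delta>sum)
      qed
      also have "\<dots> \<le> (real r - real a) * (real q - real a) + (real r - real a) * \<epsilon>
          - (real r + 1 - real a - \<epsilon>) * (real q - 1 - real a)"
        using a q by (intro diff_left_mono mult_right_mono) (auto simp: \<theta>_def)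
      \<comment> \<open>The quadratic terms cancel. The remainder is at most -1 because
        \<open>r + 2 \<le> q\<close>, and \<open>\<epsilon>\<close> was chosen so that its total
        contribution is at most 1.\<close>
      also have "\<dots> = real r - real q + 1 + \<epsilon> * ((real r - real a) + (real q - 1 - real a))"
        by (simp add: algebra_simps)
      also have "\<dots> \<le> real r - real q + 1 + \<epsilon> * (2 * real q)"
        using q \<epsilon> by (intro add_left_mono mult_left_mono) auto
      also have "\<dots> \<le> 0" using q \<epsilon> by simp
      finally show "(\<Sum>i\<in>{a..<r}. \<gamma> i) \<le> 0" .
    qed (use mono t(3) in \<open>auto intro: less_imp_le\<close>)
    finally show ?thesis .
  qed
  have "(\<Sum>i<r. T i) = (\<Sum>i<t. T i) + (\<Sum>i\<in>{t..<r}. T i)"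
  proof -
    have "{..<r} = {..<t} \<union> {t..<r}" using t(1) by auto
    then show ?thesis by (simp add: sum.union_disjoint ivl_disj_int)
  qed
  also have "\<dots> \<le> 0" using neg pos by (intro add_nonpos_nonpos sum_nonpos[of "{..<t}"]) auto
  finally have "(\<Sum>i<r. T i) \<le> 0" .
  moreover have "(\<Sum>i<r. T i) = (\<Sum>i<r. \<kappa> i * w i) + \<epsilon> * (\<Sum>i<r. \<bar>w i\<bar>) - \<theta> * (\<Sum>i<r. \<delta> i * w i)"
    by (simp add: T_def sum.distrib sum_subtractf sum_distrib_left)
  moreover have "(\<Sum>i<r. \<delta> i * w i) = (\<Sum>i<s. w i) + (real q - real r) * w s"
  proof -
    have "(\<Sum>i<s. \<delta> i * w i) = (\<Sum>i<s. w i)" by (intro sum.cong) (auto simp: \<delta>_def)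
    then show ?thesis by (simp add: r \<delta>_def)
  qed
  moreover have "\<theta> * ((\<Sum>i<s. w i) + (real q - real r) * w s) \<le> (real r + 1) * c"
  proof -
    have "\<theta> * ((\<Sum>i<s. w i) + (real q - real r) * w s) \<le> \<theta> * c"
      using constr \<theta> by (intro mult_left_mono) auto
    also have "\<dots> \<le> (real r + 1) * c" using \<theta> c by (intro mult_right_mono) auto
    finally show ?thesis .
  qed
  ultimately show ?thesis by (simp add: \<kappa>_def \<epsilon>_def)
qed

text \<open>Two geometric series meet at \<open>\<tau>\<close>, so the bound is uniform in
  \<open>E\<close> and \<open>\<tau>\<close>. The induction carries a separate closed bound on
  either side of \<open>\<tau>\<close>, with one step that crosses over.\<close>

lemma sum_powr_abs_le:
  fixes x \<tau> :: real
  assumes x: "0 < x" "x < 1"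
  shows "(\<Sum>e<E. x powr \<bar>real e - \<tau>\<bar>) \<le> 2 / (1 - x)"
proof -
  have step: "x powr (\<tau> - real E + 1) / (1 - x) + x powr (\<tau> - real E) = x powr (\<tau> - real E) / (1 - x)" for E
  proof -
    have "x powr (\<tau> - real E + 1) = x powr (\<tau> - real E) * x"
      using x by (simp only: powr_add powr_one)
    then show ?thesis using x by (simp add: field_simps)
  qed
  have "(\<Sum>e<E. x powr \<bar>real e - \<tau>\<bar>) \<le>
     (if real E \<le> \<tau> then x powr (\<tau> - real E + 1) / (1 - x) else (2 - x powr (real E - \<tau>)) / (1 - x))"
  proof (induction E)
    case 0
    have "x powr (- \<tau>) \<le> 1" if "\<not> 0 \<le> \<tau>" using that x by (intro powr_le1) auto
    then show ?case using x by (auto intro!: divide_nonneg_pos)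
  next
    case (Suc E)
    have below: "(\<Sum>e<Suc E. x powr \<bar>real e - \<tau>\<bar>) \<le> x powr (\<tau> - real E + 1) / (1 - x) + x powr (\<tau> - real E)"
      if le: "real E \<le> \<tau>"
    proof -
      have "\<bar>real E - \<tau>\<bar> = \<tau> - real E" using le by simp
      then show ?thesis
        using Suc unfolding if_P[OF le] by (simp only: sum.lessThan_Suc add_le_cancel_right)
    qed
    consider "real (Suc E) \<le> \<tau>" | "real E \<le> \<tau>" "\<tau> < real (Suc E)" | "\<tau> < real E" by linarith
    then show ?case
    proof cases
      case 1
      then have "(\<Sum>e<Suc E. x powr \<bar>real e - \<tau>\<bar>) \<le> x powr (\<tau> - real E + 1) / (1 - x) + x powr (\<tau> - real E)"
        by (intro below) simp
      also have "\<dots> = x powr (\<tau> - real E) / (1 - x)"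
        by (rule step)
      finally show ?thesis using 1 by simp
    next
      case 2
      then have "(\<Sum>e<Suc E. x powr \<bar>real e - \<tau>\<bar>) \<le> x powr (\<tau> - real E + 1) / (1 - x) + x powr (\<tau> - real E)"
        by (intro below) simp
      also have "\<dots> = x powr (\<tau> - real E) / (1 - x)"
        by (rule step)
      also have "\<dots> \<le> 1 / (1 - x)"
        using x 2 by (intro divide_right_mono powr_le1) auto
      also have "\<dots> \<le> (2 - x powr (real (Suc E) - \<tau>)) / (1 - x)"
      proof -
        have "x powr (real (Suc E) - \<tau>) \<le> 1" using x 2 by (intro powr_le1) auto
        then show ?thesis using x by (intro divide_right_mono) auto
      qed
      finally show ?thesis using 2 by simp
    next
      case 3
      then have "(\<Sum>e<Suc E. x powr \<bar>real e - \<tau>\<bar>) \<le> (2 - x powr (real E - \<tau>)) / (1 - x) + x powr (real E - \<tau>)"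
        using Suc by simp
      also have "\<dots> = (2 - x powr (real E - \<tau>) * x) / (1 - x)"
        using x by (simp add: field_simps)
      also have "x powr (real E - \<tau>) * x = x powr (real (Suc E) - \<tau>)"
      proof -
        have "real (Suc E) - \<tau> = (real E - \<tau>) + 1" by simp
        then show ?thesis using x by (simp only: powr_add powr_one)
      qed
      finally show ?thesis using 3 by simp
    qed
  qed
  also have "\<dots> \<le> 2 / (1 - x)"
  proof -
    have "x powr (\<tau> - real E + 1) \<le> 2" if "real E \<le> \<tau>"
      using powr_le1[of "\<tau> - real E + 1" x] that x by simp
    then show ?thesis using x by (auto intro!: divide_right_mono)
  qed
  finally show ?thesis .
qed

lemma dyadic_exists:
  fixes y :: real
  assumes "1 \<le> y"
  obtains e :: nat where "2 ^ e \<le> y" "y < 2 ^ Suc e"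
proof -
  define e where "e = (LEAST n. y < 2 ^ Suc n)"
  obtain n where n: "y < 2 ^ n" using real_arch_pow[of 2 y] by auto
  have "y < 2 ^ Suc n" using n by (rule less_le_trans) simp
  then have up: "y < 2 ^ Suc e" unfolding e_def by (rule LeastI)
  have "2 ^ e \<le> y"
  proof (cases e)
    case 0
    then show ?thesis using assms by simp
  next
    case (Suc m)
    then have "\<not> y < 2 ^ Suc m" using not_less_Least[of m "\<lambda>n. y < 2 ^ Suc n"] by (simp add: e_def)
    then show ?thesis using Suc by simp
  qed
  then show thesis using that up by blast
qed

text \<open>Each \<open>w a\<close> is added once for every later index and subtracted once for
  every earlier one.\<close>

lemma sum_pairwise_diff:
  fixes w :: "nat \<Rightarrow> real"
  shows "(\<Sum>a<r. \<Sum>l<a. w l - w a) = (\<Sum>a<r. (real r - 1 - 2 * real a) * w a)"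
proof (induction r)
  case (Suc r)
  have "(\<Sum>a<r. (real (Suc r) - 1 - 2 * real a) * w a)
     = (\<Sum>a<r. (real r - 1 - 2 * real a) * w a + w a)"
    by (intro sum.cong) (auto simp: algebra_simps)
  then show ?case using Suc by (simp add: sum.distrib sum_subtractf algebra_simps)
qed simp

lemma dim_span_seq:
  fixes x :: "nat \<Rightarrow> 'a::euclidean_space"
  assumes "\<And>i. i < m \<Longrightarrow> x i \<notin> span (x ` {..<i})"
  shows "dim (span (x ` {..<m})) = m"
  using seq_independent[of m x] assms by (simp add: dim_eq_card_independent card_image)

section \<open>Span counts relative to the critical size, and their sum\<close>

context dual_box
begin

text \<open>Measured in units of \<open>\<sigma>\<close>, each step contributes
  \<open>\<sigma>\<close> times a power of \<open>M a / \<sigma>\<close>, because the product of all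
  \<open>\<sigma> / N l\<close> is \<open>\<sigma> ^ q / V = \<sigma>\<close>. The \<open>r\<close>
  factors \<open>\<sigma>\<close> form the main term, and \<open>exponent_bound\<close> turns the
  remaining powers into decay away from \<open>M l = \<sigma>\<close>.\<close>

lemma span_bound_le:
  assumes r: "r = Suc s" "r + 2 \<le> q"
    and \<sigma>: "0 < \<sigma>" "\<sigma> ^ (q - 1) = V" "\<And>l. l < q \<Longrightarrow> N l \<le> \<sigma>"
    and M: "\<And>l. l < r \<Longrightarrow> 0 < M l" "\<And>i l. i \<le> l \<Longrightarrow> l < r \<Longrightarrow> M i \<le> M l"
      "\<And>l. l < r \<Longrightarrow> N l \<le> M l"
    and K: "1 \<le> K" "(\<Prod>l<s. M l) * M s ^ (q - r) \<le> K * V"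
  shows "span_bound M r \<le> ((3 * real q) ^ q) ^ r * K ^ (r + 1) * \<sigma> ^ r
     * (\<Prod>l<r. 2 powr (- \<bar>log 2 (M l / \<sigma>)\<bar> / (2 * real q)))"
proof -
  define Y where "Y l = M l / \<sigma>" for l
  define w where "w l = log 2 (Y l)" for l
  define \<kappa> where "\<kappa> a = (if w a \<le> 0 then Suc a else q)" for a
  have Y: "0 < Y l" "2 powr w l = Y l" if "l < r" for l
    using M(1)[OF that] \<sigma>(1) by (auto simp: Y_def w_def)
  have w_mono: "w i \<le> w l" if "i \<le> l" "l < r" for i l
    using M(2)[OF that] M(1)[of i] M(1)[of l] that \<sigma>(1)
    by (auto simp: w_def Y_def intro!: divide_right_mono)
  have \<sigma>q: "\<sigma> ^ q = \<sigma> * V" using \<sigma>(2) r by (cases q) auto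
  have constr: "(\<Sum>i<s. w i) + (real q - real r) * w s \<le> log 2 K"
  proof -
    have "2 powr ((\<Sum>i<s. w i) + (real q - real r) * w s)
       = 2 powr (\<Sum>i<s. w i) * (2 powr w s) powr real (q - r)"
      using r by (simp add: powr_add powr_powr of_nat_diff mult.commute)
    also have "2 powr (\<Sum>i<s. w i) = (\<Prod>l<s. Y l)"
      using Y(2) r by (simp add: powr_sum)
    also have "(2 powr w s) powr real (q - r) = Y s ^ (q - r)"
      using Y[of s] r(1) by (simp only: powr_realpow lessI)
    also have "(\<Prod>l<s. Y l) * Y s ^ (q - r) = ((\<Prod>l<s. M l) * M s ^ (q - r)) / (\<sigma> ^ s * \<sigma> ^ (q - r))"
      by (simp add: Y_def prod_dividef power_divide)
    also have "\<sigma> ^ s * \<sigma> ^ (q - r) = V"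
      using r by (simp add: power_add[symmetric] \<sigma>(2)[symmetric])
    also have "((\<Prod>l<s. M l) * M s ^ (q - r)) / V \<le> K"
      using K(2) V_ge1 by (simp add: pos_divide_le_eq)
    finally show ?thesis using K(1) by (simp add: le_log_iff)
  qed
  have "0 \<le> log 2 K" using K(1) by simp
  then have expo: "(\<Sum>a<r. (real (\<kappa> a) + real s - 2 * real a) * w a) + (\<Sum>i<r. \<bar>w i\<bar>) / (2 * real q)
      \<le> (real r + 1) * log 2 K"
    unfolding \<kappa>_def by (intro exponent_bound w_mono r constr) auto
  \<comment> \<open>If \<open>M a > \<sigma>\<close>, all maxima are the ratios
    \<open>M a / N l\<close>, which gives exponent \<open>q\<close>. Otherwise they are ratios for
    \<open>l \<le> a\<close>, as \<open>N l \<le> N a \<le> M a\<close>, and are at most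
    \<open>\<sigma> / N l\<close> for \<open>l > a\<close>, which gives exponent
    \<open>a + 1\<close>.\<close>
  have max_le: "(\<Prod>l<q. max 1 (M a / N l)) \<le> \<sigma> * 2 powr (real (\<kappa> a) * w a)" if a: "a < r" for a
  proof -
    have MY: "M a = \<sigma> * Y a" using \<sigma>(1) by (simp add: Y_def)
    have sgn: "w a \<le> 0 \<longleftrightarrow> Y a \<le> 1" using Y(1)[OF a] by (simp add: w_def)
    have "(\<Prod>l<q. max 1 (M a / N l)) \<le> (\<Prod>l<q. (\<sigma> / N l) * (if w a \<le> 0 \<and> a < l then 1 else Y a))"
    proof (intro prod_mono conjI)
      fix l assume "l \<in> {..<q}"
      then have l: "l < q" by simp
      have \<sigma>N: "1 \<le> \<sigma> / N l" using \<sigma>(3)[OF l] N_pos[OF l] by simp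
      have MN: "M a / N l = (\<sigma> / N l) * Y a" by (simp add: MY)
      show "max 1 (M a / N l) \<le> (\<sigma> / N l) * (if w a \<le> 0 \<and> a < l then 1 else Y a)"
      proof (cases "w a \<le> 0 \<and> a < l")
        case True
        then have "(\<sigma> / N l) * Y a \<le> (\<sigma> / N l) * 1" using \<sigma>N sgn by (intro mult_left_mono) auto
        then show ?thesis unfolding if_P[OF True] MN using \<sigma>N by simp
      next
        case False
        have "N l \<le> M a"
        proof (cases "w a \<le> 0")
          case True
          then have "N l \<le> N a" using False a r by (intro N_mono) auto
          then show ?thesis using M(3)[OF a] by simp
        next
          case neg: False
          then have "\<sigma> * 1 \<le> \<sigma> * Y a" using sgn \<sigma>(1) by (intro mult_left_mono) auto
          then show ?thesis using \<sigma>(3)[OF l] by (simp add: MY)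
        qed
        then have "1 \<le> M a / N l" using N_pos[OF l] by simp
        then show ?thesis unfolding if_not_P[OF False] MN by simp
      qed
    qed simp
    also have "\<dots> = (\<Prod>l<q. \<sigma> / N l) * (\<Prod>l<q. if w a \<le> 0 \<and> a < l then 1 else Y a)"
      by (rule prod.distrib)
    also have "(\<Prod>l<q. \<sigma> / N l) = \<sigma>"
      using V_ge1 \<sigma>q by (simp add: prod_dividef V_def[symmetric])
    also have "(\<Prod>l<q. if w a \<le> 0 \<and> a < l then 1 else Y a) = Y a ^ \<kappa> a"
    proof (cases "w a \<le> 0")
      case True
      have "(\<Prod>l<q. if a < l then 1 else Y a) = (\<Prod>l<Suc a. if a < l then 1 else Y a)"
        using a r by (intro prod.mono_neutral_right) auto
      also have "\<dots> = (\<Prod>l<Suc a. Y a)" by (intro prod.cong) auto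
      finally show ?thesis using True by (simp add: \<kappa>_def)
    next
      case False
      then show ?thesis by (simp add: \<kappa>_def)
    qed
    also have "Y a ^ \<kappa> a = 2 powr (real (\<kappa> a) * w a)"
    proof -
      have "2 powr (real (\<kappa> a) * w a) = (2 powr w a) powr real (\<kappa> a)"
        by (simp add: powr_powr mult.commute)
      then show ?thesis using Y[OF a] by (simp add: powr_realpow)
    qed
    finally show ?thesis .
  qed
  have ratio: "(\<Prod>l<a. M l / M a) = 2 powr (\<Sum>l<a. w l - w a)" if a: "a < r" for a
  proof -
    have "M l / M a = 2 powr (w l - w a)" if "l < a" for l
      using Y[of l] Y[OF a] a that \<sigma>(1) by (simp add: powr_diff Y_def)
    then show ?thesis by (simp add: powr_sum)
  qed
  have "span_bound M r \<le> (\<Prod>a<r. (3 * real q) ^ q * (\<sigma> * 2 powr (real (\<kappa> a) * w a)) * 2 powr (\<Sum>l<a. w l - w a))"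
    unfolding span_bound_def
  proof (intro prod_mono conjI)
    fix a assume "a \<in> {..<r}"
    then have a: "a < r" by simp
    have "0 \<le> (\<Prod>l<q. max 1 (M a / N l))" by (intro prod_nonneg) auto
    then show "0 \<le> (3 * real q) ^ q * (\<Prod>l<q. max 1 (M a / N l)) * (\<Prod>l<a. M l / M a)"
      unfolding ratio[OF a] by (intro mult_nonneg_nonneg) auto
    show "(3 * real q) ^ q * (\<Prod>l<q. max 1 (M a / N l)) * (\<Prod>l<a. M l / M a) \<le>
      (3 * real q) ^ q * (\<sigma> * 2 powr (real (\<kappa> a) * w a)) * 2 powr (\<Sum>l<a. w l - w a)"
      unfolding ratio[OF a] using max_le[OF a] by (intro mult_right_mono mult_left_mono) auto
  qed
  also have "\<dots> = ((3 * real q) ^ q) ^ r * \<sigma> ^ r * 2 powr (\<Sum>a<r. real (\<kappa> a) * w a + (\<Sum>l<a. w l - w a))"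
    by (simp add: prod.distrib powr_sum powr_add)
  also have "(\<Sum>a<r. real (\<kappa> a) * w a + (\<Sum>l<a. w l - w a))
      = (\<Sum>a<r. (real (\<kappa> a) + real s - 2 * real a) * w a)"
    unfolding sum.distrib sum_pairwise_diff
    by (simp add: sum.distrib[symmetric] r(1) algebra_simps)
  also have "((3 * real q) ^ q) ^ r * \<sigma> ^ r * 2 powr (\<Sum>a<r. (real (\<kappa> a) + real s - 2 * real a) * w a)
     \<le> ((3 * real q) ^ q) ^ r * \<sigma> ^ r * 2 powr ((real r + 1) * log 2 K + (\<Sum>i<r. - \<bar>w i\<bar> / (2 * real q)))"
  proof -
    have "(\<Sum>i<r. - \<bar>w i\<bar> / (2 * real q)) = - ((\<Sum>i<r. \<bar>w i\<bar>) / (2 * real q))"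
      by (simp add: sum_divide_distrib sum_negf)
    then show ?thesis using expo \<sigma>(1) by (intro mult_left_mono powr_mono) auto
  qed
  also have "2 powr ((real r + 1) * log 2 K + (\<Sum>i<r. - \<bar>w i\<bar> / (2 * real q)))
     = K ^ (r + 1) * (\<Prod>l<r. 2 powr (- \<bar>w l\<bar> / (2 * real q)))"
  proof -
    have "2 powr ((real r + 1) * log 2 K) = (2 powr log 2 K) powr real (r + 1)"
      by (simp only: powr_powr of_nat_add of_nat_1 mult.commute)
    also have "\<dots> = K ^ (r + 1)" using K(1) powr_realpow[of K "r + 1"] by simp
    finally show ?thesis by (simp only: powr_add) (simp add: powr_sum)
  qed
  finally show ?thesis by (simp add: w_def Y_def ac_simps)
qed

text \<open>The factors are the extension constants, the power of the constraint constant left by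
  \<open>exponent_bound\<close> (its \<open>2 ^ q\<close> pays for dyadic rounding), and one
  two-sided geometric series for each of the \<open>r\<close> vectors.\<close>

definition cover_const :: "real \<Rightarrow> nat \<Rightarrow> real" where
  "cover_const C r = ((3 * real q) ^ q) ^ r * (2 ^ q * minima_const C) ^ (r + 1)
     * (2 / (1 - 2 powr (- 1 / (2 * real q)))) ^ r"

lemma orthogonal_spans:
  assumes r: "r = Suc s" "r + 2 \<le> q" and C: "1 \<le> C"
    and \<sigma>: "0 < \<sigma>" "\<sigma> ^ (q - 1) = V" "\<And>l. l < q \<Longrightarrow> N l \<le> \<sigma>"
  shows "\<exists>F. finite F \<and> real (card F) \<le> cover_const C r * \<sigma> ^ r \<and> (\<forall>W\<in>F. subspace W \<and> dim W = r) \<and>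
    (\<forall>z. (\<forall>l<q. z \<bullet> u l \<in> \<int> \<and> \<bar>z \<bullet> u l\<bar> \<le> C * N l) \<longrightarrow> (\<exists>W\<in>F. \<forall>y\<in>W. z \<bullet> y = 0))"
proof -
  define K where "K = 2 ^ q * minima_const C"
  have mc: "1 \<le> minima_const C"
  proof -
    have "1 \<le> real q ^ q" using r by (intro one_le_power) auto
    then have "1 * 1 * 1 \<le> 2 ^ q * (3 * C * real q ^ q) * 3 ^ (q * q)"
      using C mult_mono[of 1 C 1 "real q ^ q"] by (intro mult_mono) auto
    then show ?thesis by (simp add: minima_const_def)
  qed
  have K1: "1 \<le> K" unfolding K_def using mult_mono[of 1 "2 ^ q" 1 "minima_const C"] mc by simp
  define M where "M e l = (2::real) ^ Suc (e l)" for e :: "nat \<Rightarrow> nat" and l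
  \<comment> \<open>\<open>E\<close> makes the set of dyadic profiles finite; it disappears from the
    final bound because the series converge.\<close>
  define E where "E = nat \<lceil>K * V\<rceil> + 1"
  \<comment> \<open>These conditions are the hypotheses of \<open>span_bound_le\<close>, and the
    dyadic profile of the minima of every admissible \<open>z\<close> satisfies them.\<close>
  define T where "T = {e \<in> PiE {..<r} (\<lambda>_. {..<E}). (\<forall>i l. i \<le> l \<longrightarrow> l < r \<longrightarrow> M e i \<le> M e l) \<and>
     (\<forall>l<r. N l \<le> M e l) \<and> (\<Prod>l<s. M e l) * M e s ^ (q - r) \<le> K * V}"
  define F where "F = (\<Union>e\<in>T. spans (M e) r)"
  have Mpos: "0 < M e l" for e l by (simp add: M_def)
  have finP: "finite (PiE {..<r} (\<lambda>_. {..<E}))" by (intro finite_PiE) auto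
  have finT: "finite T" unfolding T_def using finP by simp
  have spans: "finite (spans (M e) r) \<and> real (card (spans (M e) r)) \<le> span_bound (M e) r" for e
    using r by (intro card_spans Mpos) auto
  have finF: "finite F" unfolding F_def using finT spans by blast
  define x where "x = 2 powr (- 1 / (2 * real q))"
  have x: "0 < x" "x < 1" using r by (auto simp: x_def powr_less_one)
  \<comment> \<open>The shift by 1 appears because \<open>M e l\<close> is the upper end
    \<open>2 ^ (e l + 1)\<close> of its dyadic range.\<close>
  define \<tau> where "\<tau> = log 2 \<sigma> - 1"
  have decay: "2 powr (- \<bar>log 2 (M e l / \<sigma>)\<bar> / (2 * real q)) = x powr \<bar>real (e l) - \<tau>\<bar>" for e l
  proof -
    have "log 2 (M e l / \<sigma>) = real (e l) - \<tau>"
      using \<sigma>(1) by (simp add: log_divide M_def \<tau>_def log_mult log_nat_power)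
    then show ?thesis by (simp add: x_def powr_powr)
  qed
  define Q where "Q = ((3 * real q) ^ q) ^ r * K ^ (r + 1) * \<sigma> ^ r"
  have Q0: "0 \<le> Q" using K1 \<sigma>(1) by (simp add: Q_def)
  have "real (card F) \<le> (\<Sum>e\<in>T. real (card (spans (M e) r)))"
    unfolding F_def using card_UN_le[OF finT] by (metis of_nat_le_iff of_nat_sum)
  also have "\<dots> \<le> (\<Sum>e\<in>T. Q * (\<Prod>l<r. x powr \<bar>real (e l) - \<tau>\<bar>))"
  proof (rule sum_mono)
    fix e assume e: "e \<in> T"
    have "span_bound (M e) r \<le> Q * (\<Prod>l<r. 2 powr (- \<bar>log 2 (M e l / \<sigma>)\<bar> / (2 * real q)))"
      unfolding Q_def using e r \<sigma> K1 Mpos by (intro span_bound_le) (auto simp: T_def)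
    then show "real (card (spans (M e) r)) \<le> Q * (\<Prod>l<r. x powr \<bar>real (e l) - \<tau>\<bar>)"
      unfolding decay using spans[of e] by linarith
  qed
  also have "\<dots> \<le> (\<Sum>e\<in>PiE {..<r} (\<lambda>_. {..<E}). Q * (\<Prod>l<r. x powr \<bar>real (e l) - \<tau>\<bar>))"
  proof (rule sum_mono2[OF finP])
    show "T \<subseteq> PiE {..<r} (\<lambda>_. {..<E})" by (auto simp: T_def)
    show "0 \<le> Q * (\<Prod>l<r. x powr \<bar>real (e l) - \<tau>\<bar>)" for e
      using Q0 by (intro mult_nonneg_nonneg prod_nonneg) auto
  qed
  also have "\<dots> = Q * (\<Prod>l<r. \<Sum>e<E. x powr \<bar>real e - \<tau>\<bar>)"
    by (subst prod_sum_PiE) (auto simp: sum_distrib_left)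
  also have "\<dots> \<le> Q * (\<Prod>l<r. 2 / (1 - x))"
    using Q0 x by (intro mult_left_mono prod_mono conjI sum_powr_abs_le sum_nonneg) auto
  also have "\<dots> = cover_const C r * \<sigma> ^ r"
    by (simp add: Q_def cover_const_def x_def K_def)
  finally have card: "real (card F) \<le> cover_const C r * \<sigma> ^ r" .
  have dims: "subspace W \<and> dim W = r" if W: "W \<in> F" for W
  proof -
    obtain e where "W \<in> spans (M e) r" using W by (auto simp: F_def)
    then obtain y where "W = span (y ` {..<r})" "\<forall>l<r. y l \<notin> span (y ` {..<l})"
      unfolding spans_def by blast
    then show ?thesis using dim_span_seq[of r y] by simp
  qed
  have "\<exists>W\<in>F. \<forall>y\<in>W. z \<bullet> y = 0" if zz: "\<forall>l<q. z \<bullet> u l \<in> \<int> \<and> \<bar>z \<bullet> u l\<bar> \<le> C * N l" for z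
  proof -
    have z: "\<And>l. l < q \<Longrightarrow> z \<bullet> u l \<in> \<int>" "\<And>l. l < q \<Longrightarrow> \<bar>z \<bullet> u l\<bar> \<le> C * N l" using zz by auto
    interpret normed_subgroup "G z" p by (rule G_normed_subgroup)
    obtain y where y: "minima r y" using G_minima_exists[OF z C, of r] r by auto
    have yD: "y l \<in> D" "z \<bullet> y l = 0" if "l < r" for l
      using minima_mem[OF y that] by (auto simp: G_def)
    have y0: "y l \<noteq> 0" if "l < r" for l
      using minima_notin[OF y that] span_zero by metis
    have py1: "1 \<le> p (y l)" if "l < r" for l using D_p_ge1 yD y0 that by blast
    have "\<forall>l. \<exists>e::nat. l < r \<longrightarrow> 2 ^ e \<le> p (y l) \<and> p (y l) < 2 ^ Suc e"
      using dyadic_exists py1 by metis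
    then obtain e0 :: "nat \<Rightarrow> nat" where e0: "\<And>l. l < r \<Longrightarrow> 2 ^ e0 l \<le> p (y l) \<and> p (y l) < 2 ^ Suc (e0 l)"
      by metis
    define e where "e = restrict e0 {..<r}"
    have e: "2 ^ e l \<le> p (y l)" "p (y l) < M e l" "M e l \<le> 2 * p (y l)" if "l < r" for l
      using e0[OF that] that by (auto simp: e_def M_def)
    have prod_le: "(\<Prod>l<s. p (y l)) * p (y s) ^ (q - r) \<le> minima_const C * V"
      using G_minima_prod_le[OF z C, of s y] y r by simp
    have "e l < E" if l: "l < r" for l
    proof -
      have "real (e l) \<le> 2 ^ e l" by (rule less_imp_le) (rule of_nat_less_two_power)
      also have "\<dots> \<le> p (y s)" using e(1)[OF l] minima_mono[OF y, of l s] l r by simp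
      also have "p (y s) \<le> p (y s) ^ (q - r)" using py1[of s] r by (intro self_le_power) auto
      also have "\<dots> \<le> (\<Prod>l<s. p (y l)) * p (y s) ^ (q - r)"
      proof -
        have "1 \<le> (\<Prod>l<s. p (y l))" using py1 r by (intro prod_ge_1) auto
        then show ?thesis using mult_right_mono[of 1 "\<Prod>l<s. p (y l)" "p (y s) ^ (q - r)"] p_nonneg by simp
      qed
      also have "\<dots> \<le> K * V"
      proof -
        have "minima_const C \<le> 2 ^ q * minima_const C"
          using mc mult_right_mono[of 1 "2 ^ q" "minima_const C"] by simp
        then show ?thesis using prod_le V_ge1 unfolding K_def
          by (meson mult_right_mono order_trans zero_le_one)
      qed
      finally show ?thesis unfolding E_def by linarith
    qed
    then have "e \<in> PiE {..<r} (\<lambda>_. {..<E})" by (auto simp: e_def)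
    moreover have "M e i \<le> M e l" if "i \<le> l" "l < r" for i l
    proof -
      have "(2::real) ^ e i < 2 ^ Suc (e l)"
        using e(1)[of i] e(2)[of l] minima_mono[OF y that] that by (simp add: M_def)
      then have "e i < Suc (e l)" by (rule power_less_imp_less_exp[rotated]) simp
      then show ?thesis unfolding M_def by (intro power_increasing) auto
    qed
    moreover have "N l \<le> M e l" if l: "l < r" for l
    proof -
      have "N l \<le> p (y l)"
      proof (rule minima_ge_N)
        show "p (y a) \<le> p (y l)" if "a \<le> l" for a using minima_mono[OF y that l] .
      qed (use yD minima_notin[OF y] l r in auto)
      then show ?thesis using e(2)[OF l] by simp
    qed
    moreover have "(\<Prod>l<s. M e l) * M e s ^ (q - r) \<le> K * V"
    proof -
      \<comment> \<open>Rounding up loses at most a factor 2 in each of the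
        \<open>s + (q - r) = q - 1\<close> factors.\<close>
      have "(\<Prod>l<s. M e l) * M e s ^ (q - r) \<le> (\<Prod>l<s. 2 * p (y l)) * (2 * p (y s)) ^ (q - r)"
        using e(3) r p_nonneg Mpos
        by (intro mult_mono prod_mono power_mono conjI prod_nonneg) (auto simp: less_imp_le)
      also have "\<dots> = 2 ^ (s + (q - r)) * ((\<Prod>l<s. p (y l)) * p (y s) ^ (q - r))"
        by (simp add: prod.distrib power_mult_distrib power_add)
      also have "\<dots> \<le> 2 ^ q * (minima_const C * V)"
        using r p_nonneg
        by (intro mult_mono[OF _ prod_le] power_increasing mult_nonneg_nonneg prod_nonneg zero_le_power) auto
      finally show ?thesis by (simp add: K_def)
    qed
    ultimately have eT: "e \<in> T" by (simp add: T_def)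
    have "span (y ` {..<r}) \<in> spans (M e) r"
      unfolding spans_def using yD minima_notin[OF y] e(2)
      by (intro CollectI exI[of _ y]) (auto intro: less_imp_le)
    then have "span (y ` {..<r}) \<in> F" using eT by (auto simp: F_def)
    moreover have "span (y ` {..<r}) \<subseteq> {v. z \<bullet> v = 0}"
    proof (rule span_minimal)
      show "y ` {..<r} \<subseteq> {v. z \<bullet> v = 0}" using yD by auto
      show "subspace {v. z \<bullet> v = 0}" by (auto simp: subspace_def inner_add_right)
    qed
    ultimately show ?thesis by blast
  qed
  then show ?thesis using finF card dims by blast
qed

text \<open>Elements of \<open>D\<close> see \<open>z\<close> only through the integers
  \<open>z \<bullet> u l\<close>, so one subspace serves all points with the same entries, and there
  are O(\<open>V\<close>) entry vectors. In the application \<open>V\<close> equals \<sigma>^(q-1) =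
  \<sigma>^r.\<close>

lemma orthogonal_spans_codim_one:
  assumes q: "q = Suc r" and C: "1 \<le> C"
  shows "\<exists>F. finite F \<and> real (card F) \<le> (3 * C) ^ q * V \<and> (\<forall>W\<in>F. subspace W \<and> dim W = r) \<and>
    (\<forall>z. (\<forall>l<q. z \<bullet> u l \<in> \<int> \<and> \<bar>z \<bullet> u l\<bar> \<le> C * N l) \<longrightarrow> (\<exists>W\<in>F. \<forall>y\<in>W. z \<bullet> y = 0))"
proof -
  define A where "A l = {- \<lfloor>C * N l\<rfloor>..\<lfloor>C * N l\<rfloor>}" for l
  \<comment> \<open>Keeping only entry vectors realised by some \<open>z0\<close> lets the minimal
    vectors of \<open>G z0\<close> provide the subspace.\<close>
  define T where "T = {c \<in> PiE {..<q} A. \<exists>z. \<forall>l<q. z \<bullet> u l = of_int (c l)}"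
  have finP: "finite (PiE {..<q} A)" by (intro finite_PiE) (auto simp: A_def)
  have CN: "1 \<le> C * N l" if "l < q" for l using mult_mono[of 1 C 1 "N l"] C N_ge1[OF that] by simp
  have "\<exists>W. subspace W \<and> dim W = r \<and> (\<forall>z. (\<forall>l<q. z \<bullet> u l = of_int (c l)) \<longrightarrow> (\<forall>y\<in>W. z \<bullet> y = 0))"
    if "c \<in> T" for c
  proof -
    from that obtain z0 where c: "c \<in> PiE {..<q} A" and z0: "\<And>l. l < q \<Longrightarrow> z0 \<bullet> u l = of_int (c l)"
      by (auto simp: T_def)
    interpret normed_subgroup "G z0" p by (rule G_normed_subgroup)
    have "\<bar>z0 \<bullet> u l\<bar> \<le> C * N l" if "l < q" for l
    proof -
      have "c l \<in> A l" using c that by auto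
      then have "\<bar>c l\<bar> \<le> \<lfloor>C * N l\<rfloor>" by (auto simp: A_def)
      then show ?thesis using z0[OF that] by (simp add: le_floor_iff)
    qed
    then obtain y where y: "minima r y"
      using G_minima_exists[of z0 C r] z0 C q by auto
    have "z \<bullet> v = 0" if z: "\<forall>l<q. z \<bullet> u l = of_int (c l)" and v: "v \<in> span (y ` {..<r})" for z v
    proof -
      have "span (y ` {..<r}) \<subseteq> {v. z \<bullet> v = 0}"
      proof (rule span_minimal)
        show "y ` {..<r} \<subseteq> {v. z \<bullet> v = 0}"
        proof clarify
          fix i assume "i < r"
          then have "y i \<in> G z0" using minima_mem[OF y] by blast
          then have yi: "y i \<in> D" "z0 \<bullet> y i = 0" by (auto simp: G_def)
          obtain a :: "nat \<Rightarrow> int" where a: "y i = (\<Sum>l<q. of_int (a l) *\<^sub>R u l)"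
            using D_expand[OF yi(1)] by blast
          have "z \<bullet> y i = z0 \<bullet> y i" unfolding a inner_sum_right using z z0 by (intro sum.cong) auto
          then show "z \<bullet> y i = 0" using yi by simp
        qed
        show "subspace {v. z \<bullet> v = 0}" by (auto simp: subspace_def inner_add_right)
      qed
      then show ?thesis using v by blast
    qed
    moreover have "dim (span (y ` {..<r})) = r" using dim_span_seq[of r y] minima_notin[OF y] by blast
    ultimately show ?thesis using subspace_span by blast
  qed
  then obtain W where W: "\<And>c. c \<in> T \<Longrightarrow> subspace (W c) \<and> dim (W c) = r \<and>
      (\<forall>z. (\<forall>l<q. z \<bullet> u l = of_int (c l)) \<longrightarrow> (\<forall>y\<in>W c. z \<bullet> y = 0))" by metis
  have finT: "finite T" unfolding T_def using finP by simp
  have "card (W ` T) \<le> card (PiE {..<q} A)"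
    using card_image_le[OF finT, of W] card_mono[OF finP, of T] by (auto simp: T_def)
  then have "real (card (W ` T)) \<le> real (card (PiE {..<q} A))" by simp
  also have "\<dots> = (\<Prod>l<q. real (card (A l)))" by (simp add: card_PiE)
  also have "\<dots> \<le> (\<Prod>l<q. 3 * C * N l)"
  proof (intro prod_mono conjI)
    fix l assume "l \<in> {..<q}"
    then have 1: "1 \<le> C * N l" using CN by simp
    then have "0 \<le> \<lfloor>C * N l\<rfloor>" by simp
    then have "real (card (A l)) = 2 * of_int \<lfloor>C * N l\<rfloor> + 1" by (simp add: A_def)
    also have "\<dots> \<le> 2 * (C * N l) + 1" by simp
    also have "\<dots> \<le> 3 * C * N l" using 1 by simp
    finally show "real (card (A l)) \<le> 3 * C * N l" .
  qed simp
  also have "\<dots> = (3 * C) ^ q * V" by (simp add: V_def prod.distrib)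
  finally have card: "real (card (W ` T)) \<le> (3 * C) ^ q * V" .
  have "\<exists>W'\<in>W ` T. \<forall>y\<in>W'. z \<bullet> y = 0" if z: "\<forall>l<q. z \<bullet> u l \<in> \<int> \<and> \<bar>z \<bullet> u l\<bar> \<le> C * N l" for z
  proof -
    define c where "c = restrict (\<lambda>l. \<lfloor>z \<bullet> u l\<rfloor>) {..<q}"
    have c: "z \<bullet> u l = of_int (c l)" if "l < q" for l using z that by (simp add: c_def)
    have cA: "c l \<in> A l" if "l < q" for l
    proof -
      have "\<bar>z \<bullet> u l\<bar> \<le> C * N l" using z that by blast
      then have "\<bar>of_int (c l)\<bar> \<le> C * N l" using c[OF that] by simp
      then have "\<bar>c l\<bar> \<le> \<lfloor>C * N l\<rfloor>" by (simp add: le_floor_iff)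
      then show ?thesis by (auto simp: A_def)
    qed
    have "c \<in> PiE {..<q} A"
    proof (rule PiE_I)
      show "c l \<in> A l" if "l \<in> {..<q}" for l using cA that by simp
      show "c l = undefined" if "l \<notin> {..<q}" for l using that by (simp add: c_def)
    qed
    then have "c \<in> T" unfolding T_def using c by blast
    then show ?thesis using W c by blast
  qed
  moreover have "\<forall>W'\<in>W ` T. subspace W' \<and> dim W' = r" using W by blast
  ultimately show ?thesis using card finT by blast
qed

end

section \<open>The covering\<close>

lemma powr_root_power:
  fixes X :: real
  assumes "0 < X" "0 < n"
  shows "(X powr (- 1 / real n)) ^ n = 1 / X"
proof -
  have "(X powr (- 1 / real n)) ^ n = (X powr (- 1 / real n)) powr real n"
    using assms by (simp add: powr_realpow)
  also have "\<dots> = X powr - 1" using assms by (simp add: powr_powr)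
  also have "\<dots> = 1 / X" using assms by (simp add: powr_minus_divide)
  finally show ?thesis .
qed

text \<open>This is where the choice of a minimising \<open>j\<close> enters: all box sides kept are at most \<open>\<alpha>\<close>.\<close>

lemma geometric_mean_ge_first:
  fixes s f :: "nat \<Rightarrow> real"
  assumes f_def: "\<And>j. f j = (\<Prod>i\<in>{j..d}. s i) powr (- 1 / real (d - j))"
    and s: "\<And>i. j \<le> i \<Longrightarrow> i \<le> d \<Longrightarrow> 0 < s i" and j: "Suc j < d" and le: "f j \<le> f (Suc j)"
  shows "1 / s j \<le> f j"
proof -
  define P where "P = (\<Prod>i\<in>{Suc j..d}. s i)"
  have P: "0 < P" unfolding P_def using s by (intro prod_pos) auto
  have sj: "0 < s j" using s j by simp
  have split: "(\<Prod>i\<in>{j..d}. s i) = s j * P"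
    unfolding P_def using j by (intro prod.atLeast_Suc_atMost) simp
  have fj: "f j ^ (d - j) = 1 / (s j * P)"
    unfolding f_def split using P sj j by (intro powr_root_power) auto
  have fj': "f (Suc j) ^ (d - Suc j) = 1 / P"
    unfolding f_def P_def[symmetric] using P j by (intro powr_root_power) auto
  have pos: "0 < f j" unfolding f_def split using P sj by simp
  have "f j ^ (d - Suc j) \<le> 1 / P" unfolding fj'[symmetric] using le pos by (intro power_mono) auto
  then have "(1 / s j) * f j ^ (d - Suc j) \<le> (1 / s j) * (1 / P)" using sj by (intro mult_left_mono) auto
  also have "\<dots> = f j ^ (d - j)" by (simp add: fj)
  also have "\<dots> = f j * f j ^ (d - Suc j)" using j by (simp flip: power_Suc add: Suc_diff_Suc)
  finally show ?thesis using pos by (simp add: mult_le_cancel_right del: times_divide_eq_left)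
qed

lemma cover_by_complements:
  fixes S :: "'a::euclidean_space set"
  assumes F: "finite F" "\<And>W. W \<in> F \<Longrightarrow> subspace W \<and> dim W = r"
    and S: "\<And>z. z \<in> S \<Longrightarrow> \<exists>W\<in>F. \<forall>y\<in>W. z \<bullet> y = 0"
  shows "\<exists>F'. finite F' \<and> card F' \<le> card F \<and>
     (\<forall>U\<in>F'. subspace U \<and> dim U = DIM('a) - r) \<and> S \<subseteq> \<Union>F'"
proof -
  define U where "U W = {z. \<forall>y\<in>W. orthogonal y z}" for W :: "'a set"
  have "subspace (U W)" for W unfolding U_def by (rule subspace_orthogonal_to_vectors)
  moreover have "dim (U W) = DIM('a) - r" if "W \<in> F" for W
    using dim_subspace_orthogonal_to_vectors[of W UNIV] F(2)[OF that] by (simp add: U_def)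
  moreover have "S \<subseteq> \<Union>(U ` F)"
    using S by (fastforce simp: U_def orthogonal_def inner_commute)
  ultimately show ?thesis using F(1) card_image_le[OF F(1), of U] by (intro exI[of _ "U ` F"]) auto
qed

theorem theorem3:
  fixes k :: nat
  assumes "1 \<le> k" and "k \<le> DIM('a::euclidean_space) - 1"
  shows "\<exists>C>0. \<forall>(L::'a set) K. is_lattice L \<longrightarrow> sym_convex_body K \<longrightarrow>
           succ_min L K DIM('a) \<le> 1 \<longrightarrow>
           (\<exists>F. finite F \<and> (\<forall>V\<in>F. subspace V \<and> dim V = k) \<and>
                L \<inter> K \<subseteq> \<Union>F \<and>
                real (card F) \<le> C * (Min ((\<lambda>j. (\<Prod>i\<in>{j..DIM('a)}. succ_min L K i)
                      powr (- 1 / real (DIM('a) - j))) ` {1..k})) ^ (DIM('a) - k))"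
proof -
  define d where "d = DIM('a)"
  define r where "r = d - k"
  \<comment> \<open>The constant of \<open>flag_coordinate_bound\<close> with
    \<open>m = d\<close>.\<close>
  define C where "C = 3 ^ (d * d) * (1 + 2 * real (d * d)) ^ d"
  have C1: "1 \<le> C" unfolding C_def
    using mult_mono[of 1 "3 ^ (d * d)" 1 "(1 + 2 * real (d * d)) ^ d"] by simp
  have kd: "1 \<le> k" "k < d" using assms by (auto simp: d_def)
  \<comment> \<open>\<open>q = Suc r\<close> is the case \<open>j = k\<close>. The index
    \<open>j\<close>, and with it \<open>q\<close>, depends on the lattice and the body; adding the
    constants for all \<open>q \<le> d\<close> gives one that depends on \<open>d\<close> and
    \<open>k\<close> only.\<close>
  define B where "B q = (if q = Suc r then (3 * C) ^ q else dual_box.cover_const q C r)" for q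
  define Ctot where "Ctot = 1 + (\<Sum>q\<le>d. \<bar>B q\<bar>)"
  have B_le: "B q \<le> Ctot" if "q \<le> d" for q
  proof -
    have "\<bar>B q\<bar> \<le> (\<Sum>q\<le>d. \<bar>B q\<bar>)" using that by (intro member_le_sum) auto
    then show ?thesis by (simp add: Ctot_def)
  qed
  have "\<exists>F. finite F \<and> (\<forall>V\<in>F. subspace V \<and> dim V = k) \<and> L \<inter> K \<subseteq> \<Union>F \<and>
       real (card F) \<le> Ctot * (Min ((\<lambda>j. (\<Prod>i\<in>{j..d}. succ_min L K i)
                      powr (- 1 / real (d - j))) ` {1..k})) ^ r"
    if L: "is_lattice L" and K: "sym_convex_body K" and small: "succ_min L K d \<le> 1"
    for L K :: "'a set"
  proof -
    interpret G: normed_subgroup L "gauge_fun K" using lattice_normed_subgroup[OF L K] .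
    obtain x where x: "G.minima d x" using lattice_minima_exists[OF L K] by (auto simp: d_def)
    obtain b where b: "G.flag_basis d x b"
      using G.flag_basis_exists G.minima_mem[OF x] G.minima_notin[OF x] by metis
    obtain bs where bs: "\<And>i l. i < d \<Longrightarrow> l < d \<Longrightarrow> bs i \<bullet> b l = (if i = l then 1 else 0)"
      using dual_seq[of d b] G.flag_basis_notin[OF b] by metis
    define \<mu> where "\<mu> i = succ_min L K (Suc i)" for i
    have \<mu>: "\<mu> i = gauge_fun K (x i)" if "i < d" for i
      unfolding \<mu>_def using that x by (intro succ_min_eq[OF L K]) (auto simp: d_def)
    have \<mu>_pos: "0 < \<mu> i" if "i < d" for i using \<mu>[OF that] G.minima_pos[OF x that] by simp
    have \<mu>_mono: "\<mu> i \<le> \<mu> l" if "i \<le> l" "l < d" for i l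
      using G.minima_mono[OF x that] \<mu>[of i] \<mu>[of l] that by simp
    have "\<mu> (d - 1) \<le> 1" using small kd by (simp add: \<mu>_def)
    then have \<mu>_le1: "\<mu> i \<le> 1" if "i < d" for i
      using that by (intro order_trans[OF \<mu>_mono[of i "d - 1"]]) auto
    define f where "f j = (\<Prod>i\<in>{j..d}. succ_min L K i) powr (- 1 / real (d - j))" for j
    define \<sigma> where "\<sigma> = Min (f ` {1..k})"
    have "\<sigma> \<in> f ` {1..k}" unfolding \<sigma>_def using kd by (intro Min_in) auto
    then obtain j where j: "1 \<le> j" "j \<le> k" "\<sigma> = f j" by auto
    have \<sigma>_le: "\<sigma> \<le> f i" if "1 \<le> i" "i \<le> k" for i unfolding \<sigma>_def using that by (intro Min_le) auto
    define q where "q = d - j + 1"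
    have q: "q \<le> d" "r < q" "2 \<le> q" "d - j = q - 1" using j kd by (auto simp: q_def r_def)
    \<comment> \<open>The order is reversed: the largest minima come first, so that \<open>N\<close>
      is nondecreasing. Pairing with the dual basis reads off the coordinate of a point along
      \<open>b (d - 1 - l)\<close>.\<close>
    define u where "u l = bs (d - 1 - l)" for l
    define w where "w l = b (d - 1 - l)" for l
    define N where "N l = 1 / \<mu> (d - 1 - l)" for l
    interpret D: dual_box q u w N
    proof
      show "u i \<bullet> w l = (if i = l then 1 else 0)" if "i < q" "l < q" for i l
        using bs[of "d - 1 - i" "d - 1 - l"] that q by (auto simp: u_def w_def)
      show "1 \<le> N l" if "l < q" for l
        using \<mu>_le1[of "d - 1 - l"] \<mu>_pos[of "d - 1 - l"] that q by (simp add: N_def)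
      show "N i \<le> N l" if "i \<le> l" "l < q" for i l
        using \<mu>_mono[of "d - 1 - l" "d - 1 - i"] \<mu>_pos[of "d - 1 - l"] that q
        by (auto simp: N_def intro!: divide_left_mono mult_pos_pos \<mu>_pos)
    qed
    have spos: "0 < succ_min L K i" if "1 \<le> i" "i \<le> d" for i
      using \<mu>_pos[of "i - 1"] that by (simp add: \<mu>_def)
    have Ppos: "0 < (\<Prod>i\<in>{j..d}. succ_min L K i)" using j spos by (intro prod_pos) auto
    have V: "D.V = 1 / (\<Prod>i\<in>{j..d}. succ_min L K i)"
    proof -
      have "(\<Prod>l<q. succ_min L K (d - l)) = (\<Prod>i\<in>{j..d}. succ_min L K i)"
        using j kd by (intro prod.reindex_bij_witness[of _ "\<lambda>i. d - i" "\<lambda>l. d - l"]) (auto simp: q_def)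
      moreover have "(\<Prod>l<q. N l) = (\<Prod>l<q. 1 / succ_min L K (d - l))"
        using q by (intro prod.cong) (auto simp: N_def \<mu>_def Suc_diff_Suc)
      ultimately show ?thesis by (simp add: D.V_def prod_dividef)
    qed
    have \<sigma>_pos: "0 < \<sigma>" unfolding j(3) f_def powr_gt_zero using Ppos by linarith
    have \<sigma>V: "\<sigma> ^ (q - 1) = D.V"
      unfolding j(3) f_def V q(4) using Ppos q by (intro powr_root_power) auto
    have cov: "\<exists>F. finite F \<and> real (card F) \<le> B q * \<sigma> ^ r \<and> (\<forall>W\<in>F. subspace W \<and> dim W = r) \<and>
      (\<forall>z. (\<forall>l<q. z \<bullet> u l \<in> \<int> \<and> \<bar>z \<bullet> u l\<bar> \<le> C * N l) \<longrightarrow> (\<exists>W\<in>F. \<forall>y\<in>W. z \<bullet> y = 0))"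
    proof (cases "j = k")
      case True
      then have qr: "q = Suc r" using kd by (simp add: q_def r_def)
      then show ?thesis using D.orthogonal_spans_codim_one[OF qr C1] \<sigma>V by (simp add: B_def)
    next
      case False
      then have jk: "j < k" using j by simp
      then have qr: "r + 2 \<le> q" "q \<noteq> Suc r" using kd by (auto simp: q_def r_def)
      have "1 / succ_min L K j \<le> \<sigma>"
        unfolding j(3)
      \<comment> \<open>Since \<open>j < k\<close>, the index \<open>Suc j\<close> also competes in
        the minimum that defines \<open>\<sigma>\<close>.\<close>
      proof (rule geometric_mean_ge_first[OF f_def])
        show "f j \<le> f (Suc j)" using \<sigma>_le[of "Suc j"] jk j(3) by simp
      qed (use spos j jk kd in auto)
      moreover have "N (q - 1) = 1 / succ_min L K j" using j kd by (simp add: N_def q_def \<mu>_def)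
      ultimately have top: "N (q - 1) \<le> \<sigma>" by simp
      have N_le: "N l \<le> \<sigma>" if "l < q" for l
        using that by (intro order_trans[OF D.N_mono[of l "q - 1"] top]) auto
      obtain s where s: "r = Suc s" using kd by (cases r) (auto simp: r_def)
      show ?thesis
        using D.orthogonal_spans[OF s qr(1) C1 \<sigma>_pos \<sigma>V N_le] qr(2) by (simp add: B_def)
    qed
    then obtain F where F: "finite F" "real (card F) \<le> B q * \<sigma> ^ r" "\<And>W. W \<in> F \<Longrightarrow> subspace W \<and> dim W = r"
      "\<And>z. (\<forall>l<q. z \<bullet> u l \<in> \<int> \<and> \<bar>z \<bullet> u l\<bar> \<le> C * N l) \<Longrightarrow> (\<exists>W\<in>F. \<forall>y\<in>W. z \<bullet> y = 0)"
      by auto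
    \<comment> \<open>The minimal vectors span the whole space, so every lattice point has integer
      coordinates in the flag basis.\<close>
    have full: "span (x ` {..<d}) = UNIV"
      using dim_span_seq[of d x] G.minima_notin[OF x] dim_eq_full[of "x ` {..<d}"] by (simp add: d_def)
    have box: "z \<bullet> u l \<in> \<int> \<and> \<bar>z \<bullet> u l\<bar> \<le> C * N l" if z: "z \<in> L \<inter> K" and l: "l < q" for z l
    proof -
      have gz: "gauge_fun K z \<le> 1" using z gauge_fun_le_iff[OF K, of 1 z] by simp
      obtain c :: "nat \<Rightarrow> int" where c: "z = (\<Sum>i<d. of_int (c i) *\<^sub>R b i)"
        using G.flag_basis_comb[OF b, of d z] z full by auto
      define i where "i = d - 1 - l"
      have i: "i < d" using l q by (simp add: i_def)
      have zu: "z \<bullet> u l = of_int (c i)"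
        unfolding c u_def i_def[symmetric] using i bs by (intro inner_comb_dual) (auto simp: inner_commute)
      have "\<bar>real_of_int (c i)\<bar> * gauge_fun K (x i) \<le> C"
        unfolding C_def using z gz \<mu> \<mu>_le1 by (intro G.flag_coordinate_bound[OF x b _ _ _ c i]) auto
      then have "\<bar>real_of_int (c i)\<bar> \<le> C * N l"
        unfolding N_def i_def[symmetric] using \<mu>[OF i] \<mu>_pos[OF i] by (simp add: field_simps)
      then show ?thesis by (simp add: zu)
    qed
    have "\<exists>W\<in>F. \<forall>y\<in>W. z \<bullet> y = 0" if "z \<in> L \<inter> K" for z using F(4) box that by blast
    then obtain F' where F': "finite F'" "card F' \<le> card F"
        "\<forall>U\<in>F'. subspace U \<and> dim U = DIM('a) - r" "L \<inter> K \<subseteq> \<Union>F'"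
      using cover_by_complements[OF F(1,3), of "L \<inter> K"] by blast
    have "real (card F') \<le> B q * \<sigma> ^ r" using F(2) F'(2) by linarith
    also have "\<dots> \<le> Ctot * \<sigma> ^ r" using B_le[OF q(1)] \<sigma>_pos by (intro mult_right_mono) auto
    finally have "real (card F') \<le> Ctot * \<sigma> ^ r" .
    moreover have "DIM('a) - r = k" using kd by (simp add: r_def d_def)
    ultimately show ?thesis using F' unfolding \<sigma>_def f_def by auto
  qed
  moreover have "0 < Ctot" unfolding Ctot_def by (simp add: add_pos_nonneg sum_nonneg)
  ultimately show ?thesis unfolding d_def r_def by blast
qed

end
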